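(* Let $r_0>0$, $E>0$, let $\Omega=\{x\in\mathbb{R}^2:|x|<r_0\}$ be a disk, and let $(u_\omega,u_{2\omega})$ solve the second harmonic generation system on $\Omega$ (defined in the context) with uniform background field $H(x)=-Ex_1$. Then dipole radiation is forbidden: the second harmonic field has no term of order $|x|^{-1}$ at infinity, i.e. $u_{2\omega}(x)=O(|x|^{-2})$ as $|x|\to\infty$.
   Context: Second harmonic generation system on a bounded domain $D\subset\mathbb{R}^2$ with background $H$ (a harmonic function in $\mathbb{R}^2$): fix constants $\varepsilon_\omega,\varepsilon_{2\omega}\neq-1$ (permittivities) and $\chi_\perp^s,\chi_\parallel^s$ (surface susceptibilities). Let $\nu$ be the outward unit normal and $T$ the unit tangent on $\partial D$; subscripts $+$ and $-$ denote limits from outside and inside $D$. The pair $(u_\omega,u_{2\omega})$ satisfies: $\Delta u_\omega=\Delta u_{2\omega}=0$ in $\mathbb{R}^2\setminus\partial D$; on $\partial D$, $u_\omega|_+=u_\omega|_-$, $\partial_\nu u_\omega|_+=\varepsilon_\omega\partial_\nu u_\omega|_-$, $u_{2\omega}|_+-u_{2\omega}|_-=4\pi P_\perp^s$, $\partial_\nu u_{2\omega}|_+-\varepsilon_{2\omega}\partial_\nu u_{2\omega}|_-=-4\pi\sigma^s$; and $u_\omega=H(x)+O(|x|^{-1})$, $u_{2\omega}=o(1)$ as $|x|\to\infty$. Here $$P_\perp^s=\chi_\perp^s\left(\varepsilon_\omega\partial_\nu u_\omega|_-\right)^2,\quad P_\parallel^s=2\chi_\parallel^s\left(\varepsilon_\omega\partial_\nu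 u_\omega|_-\right)\left(\partial_Tu_\omega|_-\right),\quad \sigma^s=-\partial_TP_\parallel^s,$$ where $\partial_T$ of a function on the boundary is the derivative with respect to arclength. *)

theory Defs
  imports "HOL-Analysis.Analysis" "HOL-Library.Landau_Symbols"
begin

section \<open>Harmonic functions in the plane\<close>

text \<open>Fields, permittivities and susceptibilities are complex; the case of real constants and
  real fields is contained in this one.\<close>

definition partial_deriv :: "2 \<Rightarrow> (real^2 \<Rightarrow> complex) \<Rightarrow> real^2 \<Rightarrow> complex" where
  "partial_deriv i u x = frechet_derivative u (at x) (axis i 1)"

definition laplacian :: "(real^2 \<Rightarrow> complex) \<Rightarrow> real^2 \<Rightarrow> complex" where
  "laplacian u x = (\<Sum>i\<in>UNIV. partial_deriv i (partial_deriv i u) x)"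

definition C2_on :: "(real^2 \<Rightarrow> complex) \<Rightarrow> (real^2) set \<Rightarrow> bool" where
  "C2_on u S \<longleftrightarrow>
     (\<forall>x\<in>S. u differentiable (at x)) \<and>
     (\<forall>i. \<forall>x\<in>S. partial_deriv i u differentiable (at x)) \<and>
     (\<forall>i j. continuous_on S (partial_deriv j (partial_deriv i u)))"

definition harmonic_on :: "(real^2 \<Rightarrow> complex) \<Rightarrow> (real^2) set \<Rightarrow> bool" where
  "harmonic_on u S \<longleftrightarrow> open S \<and> C2_on u S \<and> (\<forall>x\<in>S. laplacian u x = 0)"


section \<open>Boundary geometry\<close>

text \<open>\<open>n\<close> is the outward unit normal at \<open>x\<close>: near \<open>x\<close>, every closed cone around \<open>- n\<close> that is
  narrower than a half-plane lies in \<open>D\<close>, and its mirror image lies in the exterior of \<open>D\<close>.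
  Such an \<open>n\<close> is unique.\<close>

definition is_outward_normal :: "(real^2) set \<Rightarrow> real^2 \<Rightarrow> real^2 \<Rightarrow> bool" where
  "is_outward_normal D x n \<longleftrightarrow> norm n = 1 \<and>
     (\<forall>\<epsilon>>0. \<exists>\<delta>>0. \<forall>y. 0 < dist y x \<and> dist y x < \<delta> \<longrightarrow>
        ((y - x) \<bullet> n \<le> - \<epsilon> * dist y x \<longrightarrow> y \<in> D) \<and>
        ((y - x) \<bullet> n \<ge> \<epsilon> * dist y x \<longrightarrow> y \<notin> closure D))"

definition outward_normal :: "(real^2) set \<Rightarrow> real^2 \<Rightarrow> real^2" where
  "outward_normal D x = (THE n. is_outward_normal D x n)"

text \<open>The normal rotated by a quarter turn anticlockwise. The opposite orientation would leave
  the surface charge unchanged, as the tangential derivative enters it twice.\<close>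

definition unit_tangent :: "(real^2) set \<Rightarrow> real^2 \<Rightarrow> real^2" where
  "unit_tangent D x = vector [- (outward_normal D x $ 2), outward_normal D x $ 1]"

definition C1_bounded_domain :: "(real^2) set \<Rightarrow> bool" where
  "C1_bounded_domain D \<longleftrightarrow>
     open D \<and> connected D \<and> D \<noteq> {} \<and> bounded D \<and>
     (\<forall>x\<in>frontier D. \<exists>n. is_outward_normal D x n) \<and>
     continuous_on (frontier D) (outward_normal D)"

text \<open>\<open>\<gamma>\<close> parametrizes the boundary by arclength near \<open>x = \<gamma> 0\<close>, in the direction of the unit
  tangent.\<close>

definition boundary_arc :: "(real^2) set \<Rightarrow> real^2 \<Rightarrow> (real \<Rightarrow> real^2) \<Rightarrow> bool" where
  "boundary_arc D x \<gamma> \<longleftrightarrow> \<gamma> 0 = x \<and>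
     (\<exists>\<delta>>0. \<forall>s. \<bar>s\<bar> < \<delta> \<longrightarrow>
        \<gamma> s \<in> frontier D \<and> (\<gamma> has_vector_derivative unit_tangent D (\<gamma> s)) (at s))"

definition has_tangential_deriv ::
  "(real^2) set \<Rightarrow> (real^2 \<Rightarrow> complex) \<Rightarrow> complex \<Rightarrow> real^2 \<Rightarrow> bool" where
  "has_tangential_deriv D f d x \<longleftrightarrow>
     (\<exists>\<gamma>. boundary_arc D x \<gamma> \<and> ((\<lambda>s. f (\<gamma> s)) has_vector_derivative d) (at 0))"

definition tangential_deriv ::
  "(real^2) set \<Rightarrow> (real^2 \<Rightarrow> complex) \<Rightarrow> real^2 \<Rightarrow> complex" where
  "tangential_deriv D f x = (THE d. has_tangential_deriv D f d x)"

definition tangentially_differentiable ::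
  "(real^2) set \<Rightarrow> (real^2 \<Rightarrow> complex) \<Rightarrow> bool" where
  "tangentially_differentiable D f \<longleftrightarrow>
     (\<forall>x\<in>frontier D. \<exists>d. has_tangential_deriv D f d x)"


section \<open>One-sided boundary values\<close>

definition trace_in :: "(real^2) set \<Rightarrow> (real^2 \<Rightarrow> complex) \<Rightarrow> real^2 \<Rightarrow> complex" where
  "trace_in D u x = Lim (at x within D) u"

definition trace_out :: "(real^2) set \<Rightarrow> (real^2 \<Rightarrow> complex) \<Rightarrow> real^2 \<Rightarrow> complex" where
  "trace_out D u x = Lim (at x within - closure D) u"

text \<open>\<open>\<nu>(x) \<bullet> \<nabla>u(x + t \<nu>(x))\<close> for a boundary point \<open>x\<close>.\<close>

definition offset_normal_deriv ::
  "(real^2) set \<Rightarrow> (real^2 \<Rightarrow> complex) \<Rightarrow> real \<Rightarrow> real^2 \<Rightarrow> complex" where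
  "offset_normal_deriv D u t x =
     frechet_derivative u (at (x + t *\<^sub>R outward_normal D x)) (outward_normal D x)"

definition normal_deriv_in :: "(real^2) set \<Rightarrow> (real^2 \<Rightarrow> complex) \<Rightarrow> real^2 \<Rightarrow> complex" where
  "normal_deriv_in D u x = Lim (at_left 0) (\<lambda>t. offset_normal_deriv D u t x)"

definition normal_deriv_out :: "(real^2) set \<Rightarrow> (real^2 \<Rightarrow> complex) \<Rightarrow> real^2 \<Rightarrow> complex" where
  "normal_deriv_out D u x = Lim (at_right 0) (\<lambda>t. offset_normal_deriv D u t x)"

text \<open>The usual regularity of classical solutions of transmission problems: on either side the
  function is continuous up to the boundary, and the limits that define the normal derivative
  exist uniformly on the boundary. (With merely pointwise limits, transmission problems are
  not uniquely solvable.)\<close>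

definition has_boundary_values :: "(real^2) set \<Rightarrow> (real^2 \<Rightarrow> complex) \<Rightarrow> bool" where
  "has_boundary_values D u \<longleftrightarrow>
     (\<forall>x\<in>frontier D. (u \<longlongrightarrow> trace_in D u x) (at x within D)) \<and>
     (\<forall>x\<in>frontier D. (u \<longlongrightarrow> trace_out D u x) (at x within - closure D)) \<and>
     uniform_limit (frontier D) (offset_normal_deriv D u) (normal_deriv_in D u) (at_left 0) \<and>
     uniform_limit (frontier D) (offset_normal_deriv D u) (normal_deriv_out D u) (at_right 0)"


section \<open>The second harmonic generation system\<close>

definition P_perp ::
  "(real^2) set \<Rightarrow> complex \<Rightarrow> complex \<Rightarrow> (real^2 \<Rightarrow> complex) \<Rightarrow> real^2 \<Rightarrow> complex" where
  "P_perp D \<epsilon>\<omega> \<chi>perp u\<omega> x = \<chi>perp * (\<epsilon>\<omega> * normal_deriv_in D u\<omega> x)\<^sup>2"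

definition P_par ::
  "(real^2) set \<Rightarrow> complex \<Rightarrow> complex \<Rightarrow> (real^2 \<Rightarrow> complex) \<Rightarrow> real^2 \<Rightarrow> complex" where
  "P_par D \<epsilon>\<omega> \<chi>par u\<omega> x =
     2 * \<chi>par * (\<epsilon>\<omega> * normal_deriv_in D u\<omega> x) * tangential_deriv D (trace_in D u\<omega>) x"

definition surface_charge ::
  "(real^2) set \<Rightarrow> complex \<Rightarrow> complex \<Rightarrow> (real^2 \<Rightarrow> complex) \<Rightarrow> real^2 \<Rightarrow> complex" where
  "surface_charge D \<epsilon>\<omega> \<chi>par u\<omega> x = - tangential_deriv D (P_par D \<epsilon>\<omega> \<chi>par u\<omega>) x"

definition shg_system ::
  "(real^2) set \<Rightarrow> complex \<Rightarrow> complex \<Rightarrow> complex \<Rightarrow> complex \<Rightarrow> (real^2 \<Rightarrow> complex) \<Rightarrow>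
   (real^2 \<Rightarrow> complex) \<Rightarrow> (real^2 \<Rightarrow> complex) \<Rightarrow> bool" where
  "shg_system D \<epsilon>\<omega> \<epsilon>2\<omega> \<chi>perp \<chi>par H u\<omega> u2\<omega> \<longleftrightarrow>
     C1_bounded_domain D \<and>
     harmonic_on H UNIV \<and>
     harmonic_on u\<omega> (- frontier D) \<and>
     harmonic_on u2\<omega> (- frontier D) \<and>
     has_boundary_values D u\<omega> \<and>
     has_boundary_values D u2\<omega> \<and>
     tangentially_differentiable D (trace_in D u\<omega>) \<and>
     tangentially_differentiable D (P_par D \<epsilon>\<omega> \<chi>par u\<omega>) \<and>
     (\<forall>x\<in>frontier D.
        trace_out D u\<omega> x = trace_in D u\<omega> x \<and>
        normal_deriv_out D u\<omega> x = \<epsilon>\<omega> * normal_deriv_in D u\<omega> x \<and>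
        trace_out D u2\<omega> x - trace_in D u2\<omega> x
          = complex_of_real (4 * pi) * P_perp D \<epsilon>\<omega> \<chi>perp u\<omega> x \<and>
        normal_deriv_out D u2\<omega> x - \<epsilon>2\<omega> * normal_deriv_in D u2\<omega> x
          = - complex_of_real (4 * pi) * surface_charge D \<epsilon>\<omega> \<chi>par u\<omega> x) \<and>
     (\<lambda>x. u\<omega> x - H x) \<in> O[at_infinity](\<lambda>x. complex_of_real (1 / norm x)) \<and>
     u2\<omega> \<in> o[at_infinity](\<lambda>x. 1)"

end

(* On every circle around the origin, integration by parts ties the Fourier modes M_n of a harmonic
   function and D_n of its radial derivative to the Wirtinger derivatives: holomorphy gives
   D_n = |n| M_n inside the disk and D_n = - |n| M_n outside it, for a field vanishing at infinity.
   Since a transmission problem couples boundary modes of equal index only, all modes of the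
   fundamental field with |n| >= 2 vanish in the disk (as they do for the uniform background), so its
   gradient is constant there. The sources P_perp and sigma are therefore quadratic in the normal and
   have no modes of index 1 or -1; as eps_2omega is not -1, neither has the second harmonic field,
   and these are the modes of order 1/|x|. *)

theory Submission
  imports Defs "HOL-Complex_Analysis.Conformal_Mappings"
begin

text \<open>With \<open>F\<close> and \<open>G\<close> the Wirtinger derivatives of
  \<open>U\<close>, its derivatives on a circle are i(zF - cnj z G) in the angle and zF + cnj z G
  for r dU/dr. If \<open>F\<close> and the conjugate of \<open>G\<close> extend holomorphically to
  the disk, zF has modes of index >= 1 only and cnj z G has modes of index <= -1 only. At each index
  one term survives, so both derivatives agree there up to a unit factor: this is the origin of |n|.
  No Fourier series is ever summed. Mode 1 + k of the radial derivative is a multiple of the k-th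
  Taylor coefficient of \<open>F\<close> at the centre, and negative indices serve the conjugate of
  \<open>G\<close> in the same way. The exterior is carried to a punctured disk by z -> 1/cnj z,
  which keeps angles and hence indices. A field vanishing at infinity has a limit at the puncture;
  this makes both derivatives removable there, excludes logarithms and growing terms, and turns
  O(|x|^-2) into quadratic vanishing. Boundary data exist only as one-sided limits, so each relation
  is shown on nearby circles and then passed to the limit.\<close>

section \<open>Symmetry of mixed partial derivatives\<close>

text \<open>The mean value inequality is applied to the increment of \<open>u\<close> in direction
  \<open>f\<close>, as a function of the step along \<open>e\<close>. Its derivative is an increment
  of the directional derivative along \<open>e\<close>, which differentiability at \<open>x\<close>
  approximates by \<open>h *\<^sub>R g' f\<close> up to o(h).\<close>

lemma second_difference_limit:
  fixes u :: "'a::real_normed_vector \<Rightarrow> 'b::real_normed_vector"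
  assumes "open S" "x \<in> S" and du: "\<And>y. y \<in> S \<Longrightarrow> u differentiable (at y)"
    and g': "((\<lambda>y. frechet_derivative u (at y) e) has_derivative g') (at x)"
  shows "((\<lambda>h. (u (x + h *\<^sub>R e + h *\<^sub>R f) - u (x + h *\<^sub>R e) - u (x + h *\<^sub>R f) + u x) /\<^sub>R h\<^sup>2) \<longlongrightarrow> g' f) (at_right 0)"
proof (rule tendstoI)
  fix \<epsilon> :: real assume "\<epsilon> > 0"
  define g where "g = (\<lambda>y. frechet_derivative u (at y) e)"
  \<comment> \<open>\<open>h * K\<close> exceeds the length of every offset with coefficients in
    [0, h]; the summand 1 keeps \<open>K\<close> positive even if \<open>e\<close> and
    \<open>f\<close> vanish.\<close>
  define K where "K = 2 * norm e + norm f + 1"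
  have K: "K > 0" by (simp add: K_def add_nonneg_pos)
  \<comment> \<open>Two remainders of at most \<open>\<eta> * (h * K)\<close> each, over a step of
    length \<open>h\<close>, amount to \<open>h\<^sup>2 * (\<epsilon> / 2)\<close>.\<close>
  define \<eta> where "\<eta> = \<epsilon> / (4 * K)"
  have \<eta>: "\<eta> > 0" using \<open>\<epsilon> > 0\<close> K by (simp add: \<eta>_def)
  obtain r where r: "r > 0" "ball x r \<subseteq> S" using assms(1,2) open_contains_ball by blast
  have lin: "bounded_linear g'" using g' has_derivative_bounded_linear by blast
  obtain d where d: "d > 0" "\<And>y. norm (y - x) < d \<Longrightarrow> norm (g y - g x - g' (y - x)) \<le> \<eta> * norm (y - x)"
    using g' \<eta> unfolding has_derivative_at_alt g_def by blast
  define m where "m = min r d / K"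
  have m: "m > 0" using r d K by (simp add: m_def)
  have main: "norm ((u (x + h *\<^sub>R e + h *\<^sub>R f) - u (x + h *\<^sub>R e) - u (x + h *\<^sub>R f) + u x) /\<^sub>R h\<^sup>2 - g' f) < \<epsilon>"
    if h: "0 < h" "h < m" for h
  proof -
    have hK: "h * K < r" "h * K < d"
      using h K by (auto simp: m_def field_simps)
    have small: "norm (t *\<^sub>R e + s *\<^sub>R f) < h * K" if "0 \<le> t" "t \<le> h" "0 \<le> s" "s \<le> h" for t s
    proof -
      have "norm (t *\<^sub>R e + s *\<^sub>R f) \<le> t * norm e + s * norm f"
        using norm_triangle_ineq[of "t *\<^sub>R e" "s *\<^sub>R f"] that by simp
      also have "\<dots> \<le> h * norm e + h * norm f" using that by (intro add_mono mult_right_mono) auto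
      also have "\<dots> < h * K" using h unfolding K_def distrib_left by (simp add: add_nonneg_pos)
      finally show ?thesis .
    qed
    \<comment> \<open>The expected limit is subtracted in advance, so that the derivative of
      \<open>\<phi>\<close> is a pure remainder.\<close>
    define \<phi> where "\<phi> = (\<lambda>t. u (x + t *\<^sub>R e + h *\<^sub>R f) - u (x + t *\<^sub>R e) - t *\<^sub>R (h *\<^sub>R g' f))"
    have der: "((\<lambda>t. u (x + t *\<^sub>R e + s *\<^sub>R f)) has_derivative (\<lambda>k. k *\<^sub>R g (x + t *\<^sub>R e + s *\<^sub>R f))) (at t within {0..h})"
      if "t \<in> {0..h}" "s \<in> {0, h}" for t s
    proof -
      have "x + t *\<^sub>R e + s *\<^sub>R f \<in> S"
        using small[of t s] that h hK r by (auto simp: subset_iff dist_norm norm_minus_commute add.assoc)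
      then have "(u has_derivative frechet_derivative u (at (x + t *\<^sub>R e + s *\<^sub>R f))) (at (x + t *\<^sub>R e + s *\<^sub>R f))"
        using du frechet_derivative_works by blast
      moreover have "((\<lambda>t. x + t *\<^sub>R e + s *\<^sub>R f) has_derivative (\<lambda>k. k *\<^sub>R e)) (at t within {0..h})"
        by (auto intro!: derivative_eq_intros)
      ultimately have D: "((\<lambda>t. u (x + t *\<^sub>R e + s *\<^sub>R f)) has_derivative (\<lambda>k. frechet_derivative u (at (x + t *\<^sub>R e + s *\<^sub>R f)) (k *\<^sub>R e))) (at t within {0..h})"
        using has_derivative_compose by blast
      have "frechet_derivative u (at (x + t *\<^sub>R e + s *\<^sub>R f)) (k *\<^sub>R e) = k *\<^sub>R g (x + t *\<^sub>R e + s *\<^sub>R f)" for k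
        unfolding g_def using \<open>x + t *\<^sub>R e + s *\<^sub>R f \<in> S\<close> du linear_frechet_derivative linear_scale by blast
      then show ?thesis using D by simp
    qed
    have "norm (\<phi> h - \<phi> 0) \<le> (h * (2 * \<eta> * K)) * norm (h - 0)"
    proof (rule differentiable_bound[of "{0..h}" \<phi> "\<lambda>t k. k *\<^sub>R (g (x + t *\<^sub>R e + h *\<^sub>R f) - g (x + t *\<^sub>R e) - h *\<^sub>R g' f)"])
      fix t assume t: "t \<in> {0..h}"
      show "(\<phi> has_derivative (\<lambda>k. k *\<^sub>R (g (x + t *\<^sub>R e + h *\<^sub>R f) - g (x + t *\<^sub>R e) - h *\<^sub>R g' f))) (at t within {0..h})"
        unfolding \<phi>_def using der[OF t, of h] der[OF t, of 0]
        by (auto intro!: derivative_eq_intros simp: algebra_simps)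
      let ?a = "t *\<^sub>R e + h *\<^sub>R f" and ?b = "t *\<^sub>R e"
      have na: "norm ?a < h * K" and nb: "norm ?b < h * K"
        using small[of t h] small[of t 0] t h by auto
      have "g (x + ?a) - g (x + ?b) - h *\<^sub>R g' f
          = (g (x + ?a) - g x - g' ?a) - (g (x + ?b) - g x - g' ?b)"
        using lin by (simp add: linear_simps algebra_simps)
      also have "norm \<dots> \<le> norm (g (x + ?a) - g x - g' ?a) + norm (g (x + ?b) - g x - g' ?b)"
        by (rule norm_triangle_ineq4)
      also have "\<dots> \<le> \<eta> * norm ?a + \<eta> * norm ?b"
        using d(2)[of "x + ?a"] d(2)[of "x + ?b"] na nb hK by (intro add_mono) auto
      also have "\<dots> \<le> \<eta> * (h * K) + \<eta> * (h * K)"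
        using na nb \<eta> by (intro add_mono mult_left_mono) auto
      finally have "norm (g (x + t *\<^sub>R e + h *\<^sub>R f) - g (x + t *\<^sub>R e) - h *\<^sub>R g' f) \<le> h * (2 * \<eta> * K)"
        by (simp add: algebra_simps)
      then show "onorm (\<lambda>k. k *\<^sub>R (g (x + t *\<^sub>R e + h *\<^sub>R f) - g (x + t *\<^sub>R e) - h *\<^sub>R g' f)) \<le> h * (2 * \<eta> * K)"
        unfolding norm_scaleR real_norm_def by (intro onorm_le) (simp add: mult.commute[of "\<bar>_\<bar>"] mult_right_mono)
    qed (use h in auto)
    also have "h * (2 * \<eta> * K) * norm (h - 0) = h\<^sup>2 * (\<epsilon> / 2)"
      using h K by (simp add: \<eta>_def power2_eq_square field_simps)
    finally have *: "norm (\<phi> h - \<phi> 0) \<le> h\<^sup>2 * (\<epsilon> / 2)" .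
    have "(u (x + h *\<^sub>R e + h *\<^sub>R f) - u (x + h *\<^sub>R e) - u (x + h *\<^sub>R f) + u x) /\<^sub>R h\<^sup>2 - g' f
        = (\<phi> h - \<phi> 0) /\<^sub>R h\<^sup>2"
      using h by (simp add: \<phi>_def algebra_simps power2_eq_square)
    also have "norm \<dots> \<le> \<epsilon> / 2"
      using * h by (simp add: divide_simps mult.commute)
    finally show ?thesis using \<open>\<epsilon> > 0\<close> by simp
  qed
  show "\<forall>\<^sub>F h in at_right 0. dist ((u (x + h *\<^sub>R e + h *\<^sub>R f) - u (x + h *\<^sub>R e) - u (x + h *\<^sub>R f) + u x) /\<^sub>R h\<^sup>2) (g' f) < \<epsilon>"
    unfolding eventually_at_right_field using m main by (auto simp: dist_norm)
qed

text \<open>The second difference is symmetric in \<open>e\<close> and \<open>f\<close>, so both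
  sides are limits of one and the same quotient.\<close>

lemma mixed_partial_symmetric:
  fixes u :: "'a::real_normed_vector \<Rightarrow> 'b::real_normed_vector"
  assumes "open S" "x \<in> S" "\<And>y. y \<in> S \<Longrightarrow> u differentiable (at y)"
    and "((\<lambda>y. frechet_derivative u (at y) e) has_derivative g') (at x)"
    and "((\<lambda>y. frechet_derivative u (at y) f) has_derivative h') (at x)"
  shows "g' f = h' e"
proof -
  have "((\<lambda>h. (u (x + h *\<^sub>R e + h *\<^sub>R f) - u (x + h *\<^sub>R e) - u (x + h *\<^sub>R f) + u x) /\<^sub>R h\<^sup>2) \<longlongrightarrow> g' f) (at_right 0)"
    using second_difference_limit[OF assms(1-4)] .
  moreover have "((\<lambda>h. (u (x + h *\<^sub>R e + h *\<^sub>R f) - u (x + h *\<^sub>R e) - u (x + h *\<^sub>R f) + u x) /\<^sub>R h\<^sup>2) \<longlongrightarrow> h' e) (at_right 0)"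
    using second_difference_limit[OF assms(1-3,5), of e] by (simp add: algebra_simps)
  ultimately show ?thesis using tendsto_unique trivial_limit_at_right_real by blast
qed

section \<open>Harmonic functions and their Wirtinger derivatives\<close>

definition plane :: "complex \<Rightarrow> real^2" where
  "plane z = vector [Re z, Im z]"

lemma plane_nth [simp]: "plane z $ 1 = Re z" "plane z $ 2 = Im z"
  by (simp_all add: plane_def)

lemma plane_eq: "plane z = Re z *\<^sub>R axis 1 1 + Im z *\<^sub>R axis 2 1"
  by (simp add: vec_eq_iff forall_2 axis_def)

lemma norm_plane [simp]: "norm (plane z) = norm z"
  by (simp add: norm_vec_def L2_set_def sum_2 cmod_def)

lemma bounded_linear_plane: "bounded_linear plane"
  by (rule bounded_linear_intro[where K = 1]) (simp_all add: vec_eq_iff forall_2)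

definition cplx :: "real^2 \<Rightarrow> complex" where
  "cplx x = Complex (x $ 1) (x $ 2)"

lemma plane_cplx [simp]: "plane (cplx x) = x" "cplx (plane z) = z"
  by (simp_all add: vec_eq_iff forall_2 cplx_def complex_eq_iff)

lemma bounded_linear_cplx: "bounded_linear cplx"
proof (rule bounded_linear_intro[where K = 1])
  show "norm (cplx x) \<le> norm x * 1" for x
    using norm_plane[of "cplx x"] by simp
qed (simp_all add: cplx_def complex_eq_iff)

text \<open>\<open>F\<close> and \<open>G\<close> are the Wirtinger derivatives \<open>\<partial>U/\<partial>z\<close> and \<open>\<partial>U/\<partial>(cnj z)\<close>; harmonicity of \<open>U\<close> makes
  \<open>F\<close> holomorphic and \<open>G\<close> antiholomorphic. Complex conjugation of \<open>U\<close> swaps the two.\<close>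

definition hpair :: "(complex \<Rightarrow> complex) \<Rightarrow> (complex \<Rightarrow> complex) \<Rightarrow> (complex \<Rightarrow> complex) \<Rightarrow> complex set \<Rightarrow> bool"
  where "hpair U F G S \<longleftrightarrow> open S \<and>
    (\<forall>z\<in>S. (U has_derivative (\<lambda>h. F z * h + G z * cnj h)) (at z)) \<and>
    F holomorphic_on S \<and> (\<lambda>z. cnj (G z)) holomorphic_on S"

text \<open>A real linear map is fixed by its values at 1 and \<i>, and the Cauchy-Riemann equation
  makes these the values of multiplication by \<open>f' 1\<close>.\<close>

lemma cauchy_riemann_field_derivative:
  assumes "(f has_derivative f') (at z)" and "f' \<i> = \<i> * f' 1"
  shows "(f has_field_derivative f' 1) (at z)"
proof -
  have "linear f'" using assms(1) has_derivative_linear by blast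
  have *: "f' h = f' 1 * h" for h
  proof -
    have "f' h = f' (Re h *\<^sub>R 1 + Im h *\<^sub>R \<i>)"
      by (rule arg_cong[of _ _ f']) (simp add: complex_eq_iff)
    also have "\<dots> = Re h *\<^sub>R f' 1 + Im h *\<^sub>R f' \<i>"
      using \<open>linear f'\<close> by (simp add: linear_add linear_scale)
    also have "\<dots> = f' 1 * h" by (subst (3) complex_eq) (simp add: assms(2) scaleR_conv_of_real algebra_simps)
    finally show ?thesis .
  qed
  have "f' = (*) (f' 1)" by (rule ext) (rule *)
  then show ?thesis using assms(1) by (simp add: has_field_derivative_def)
qed

text \<open>Both Cauchy-Riemann equations, for the first function and for the conjugate of the
  second, reduce to the same two facts: equal mixed partials and a vanishing Laplacian.\<close>

lemma harmonic_hpair: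
  assumes "harmonic_on u S"
  shows "hpair (u \<circ> plane)
    (\<lambda>z. (partial_deriv 1 u (plane z) - \<i> * partial_deriv 2 u (plane z)) / 2)
    (\<lambda>z. (partial_deriv 1 u (plane z) + \<i> * partial_deriv 2 u (plane z)) / 2) (plane -` S)"
proof -
  let ?p = "\<lambda>i. partial_deriv i u" and ?S = "plane -` S"
  have S: "open S" and du: "\<And>x. x \<in> S \<Longrightarrow> u differentiable (at x)"
    and dp: "\<And>i x. x \<in> S \<Longrightarrow> ?p i differentiable (at x)" and lap: "\<And>x. x \<in> S \<Longrightarrow> laplacian u x = 0"
    using assms by (auto simp: harmonic_on_def C2_on_def)
  have oS: "open ?S"
    using S bounded_linear_plane by (simp add: continuous_open_vimage linear_continuous_at)
  have comp: "((v \<circ> plane) has_derivative (\<lambda>h. v' (plane h))) (at z)"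
    if "(v has_derivative v') (at (plane z))" for v :: "real^2 \<Rightarrow> complex" and v' z
    using has_derivative_compose[OF bounded_linear_imp_has_derivative[OF bounded_linear_plane] that]
    by (simp add: o_def)
  have U: "((u \<circ> plane) has_derivative (\<lambda>h. (?p 1 (plane z) - \<i> * ?p 2 (plane z)) / 2 * h
      + (?p 1 (plane z) + \<i> * ?p 2 (plane z)) / 2 * cnj h)) (at z)" if z: "z \<in> ?S" for z
  proof -
    let ?D = "frechet_derivative u (at (plane z))"
    have D: "(u has_derivative ?D) (at (plane z))" using z du frechet_derivative_works by auto
    have "?D (plane h) = (?p 1 (plane z) - \<i> * ?p 2 (plane z)) / 2 * h
      + (?p 1 (plane z) + \<i> * ?p 2 (plane z)) / 2 * cnj h" for h
    proof -
      have "?D (plane h) = Re h *\<^sub>R ?p 1 (plane z) + Im h *\<^sub>R ?p 2 (plane z)"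
        unfolding plane_eq[of h] linear_add[OF has_derivative_linear[OF D]]
          linear_scale[OF has_derivative_linear[OF D]] partial_deriv_def ..
      also have "\<dots> = (?p 1 (plane z) * (h + cnj h) - \<i> * ?p 2 (plane z) * (h - cnj h)) / 2"
        unfolding complex_add_cnj complex_diff_cnj scaleR_conv_of_real
        by (simp add: algebra_simps)
      also have "\<dots> = (?p 1 (plane z) - \<i> * ?p 2 (plane z)) / 2 * h
        + (?p 1 (plane z) + \<i> * ?p 2 (plane z)) / 2 * cnj h"
        by (simp add: field_simps)
      finally show ?thesis .
    qed
    then show ?thesis using comp[OF D] by simp
  qed
  let ?q = "\<lambda>i x. frechet_derivative (?p i) (at x)"
  have q: "(?p i has_derivative ?q i x) (at x)" if "x \<in> S" for i x
    using dp that frechet_derivative_works by blast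
  have sym: "?q 1 x (axis 2 1) = ?q 2 x (axis 1 1)" if "x \<in> S" for x
    using mixed_partial_symmetric[OF S that du q[OF that, of 1, unfolded partial_deriv_def[abs_def]]
        q[OF that, of 2, unfolded partial_deriv_def[abs_def]]]
    unfolding partial_deriv_def[abs_def] by simp
  have lp: "?q 1 x (axis 1 1) + ?q 2 x (axis 2 1) = 0" if "x \<in> S" for x
    using lap[OF that] by (simp add: laplacian_def sum_2 partial_deriv_def[of _ "?p _"])
  then have lp': "?q 2 x (axis 2 1) = - ?q 1 x (axis 1 1)" if "x \<in> S" for x
    using that by (metis add.commute add_eq_0_iff)
  have dq: "((\<lambda>z. ?p i (plane z)) has_derivative (\<lambda>h. ?q i (plane z) (plane h))) (at z)" if "z \<in> ?S" for i z
    using comp[OF q] that by (auto simp: o_def)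
  have pl: "plane 1 = axis 1 1" "plane \<i> = axis 2 1" by (simp_all add: plane_eq)
  have F: "(\<lambda>z. (?p 1 (plane z) - \<i> * ?p 2 (plane z)) / 2) holomorphic_on ?S"
  proof (rule holomorphic_onI)
    fix z assume z: "z \<in> ?S"
    have e: "(?q 1 (plane z) (axis 2 1) - \<i> * ?q 2 (plane z) (axis 2 1)) / 2
        = \<i> * ((?q 1 (plane z) (axis 1 1) - \<i> * ?q 2 (plane z) (axis 1 1)) / 2)"
      using sym[of "plane z"] z by (simp add: lp' algebra_simps)
    have "((\<lambda>z. (?p 1 (plane z) - \<i> * ?p 2 (plane z)) / 2) has_derivative
       (\<lambda>h. (?q 1 (plane z) (plane h) - \<i> * ?q 2 (plane z) (plane h)) / 2)) (at z)"
      by (auto intro!: derivative_eq_intros dq z)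
    from cauchy_riemann_field_derivative[OF this] have "(\<lambda>z. (?p 1 (plane z) - \<i> * ?p 2 (plane z)) / 2) field_differentiable (at z)"
      unfolding field_differentiable_def by (metis e pl)
    then show "(\<lambda>z. (?p 1 (plane z) - \<i> * ?p 2 (plane z)) / 2) field_differentiable at z within ?S"
      by (rule field_differentiable_at_within)
  qed
  have G: "(\<lambda>z. cnj ((?p 1 (plane z) + \<i> * ?p 2 (plane z)) / 2)) holomorphic_on ?S"
  proof (rule holomorphic_onI)
    fix z assume z: "z \<in> ?S"
    have e: "cnj ((?q 1 (plane z) (axis 2 1) + \<i> * ?q 2 (plane z) (axis 2 1)) / 2)
        = \<i> * cnj ((?q 1 (plane z) (axis 1 1) + \<i> * ?q 2 (plane z) (axis 1 1)) / 2)"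
      using sym[of "plane z"] z by (simp add: lp' algebra_simps)
    have "((\<lambda>z. cnj ((?p 1 (plane z) + \<i> * ?p 2 (plane z)) / 2)) has_derivative
       (\<lambda>h. cnj ((?q 1 (plane z) (plane h) + \<i> * ?q 2 (plane z) (plane h)) / 2))) (at z)"
      by (auto intro!: derivative_eq_intros dq z)
    from cauchy_riemann_field_derivative[OF this] have "(\<lambda>z. cnj ((?p 1 (plane z) + \<i> * ?p 2 (plane z)) / 2)) field_differentiable (at z)"
      unfolding field_differentiable_def by (metis e pl)
    then show "(\<lambda>z. cnj ((?p 1 (plane z) + \<i> * ?p 2 (plane z)) / 2)) field_differentiable at z within ?S"
      by (rule field_differentiable_at_within)
  qed
  show ?thesis using oS U F G by (simp add: hpair_def)
qed

text \<open>This halves the work below: claims are shown for \<open>F\<close> and positive indices,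
  and applying them to the conjugate field yields \<open>G\<close> and negative indices.\<close>

lemma hpair_cnj: "hpair U F G S \<Longrightarrow> hpair (\<lambda>z. cnj (U z)) (\<lambda>z. cnj (G z)) (\<lambda>z. cnj (F z)) S"
  unfolding hpair_def
proof (intro conjI ballI; elim conjE)
  fix z assume "\<forall>z\<in>S. (U has_derivative (\<lambda>h. F z * h + G z * cnj h)) (at z)" "z \<in> S"
  then have "((\<lambda>z. cnj (U z)) has_derivative (\<lambda>h. cnj (F z * h + G z * cnj h))) (at z)"
    by (auto intro!: derivative_eq_intros)
  then show "((\<lambda>z. cnj (U z)) has_derivative (\<lambda>h. cnj (G z) * h + cnj (F z) * cnj h)) (at z)"
    by (simp add: add.commute)
qed auto

lemma hpair_subset: "hpair U F G S \<Longrightarrow> open T \<Longrightarrow> T \<subseteq> S \<Longrightarrow> hpair U F G T"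
  unfolding hpair_def using holomorphic_on_subset by blast

lemma hpair_diff:
  assumes "hpair U F G S" "hpair V P Q S"
  shows "hpair (\<lambda>z. U z - V z) (\<lambda>z. F z - P z) (\<lambda>z. G z - Q z) S"
  unfolding hpair_def
proof (intro conjI ballI)
  fix z assume "z \<in> S"
  then have "((\<lambda>z. U z - V z) has_derivative (\<lambda>h. (F z * h + G z * cnj h) - (P z * h + Q z * cnj h))) (at z)"
    using assms by (intro has_derivative_diff) (auto simp: hpair_def)
  then show "((\<lambda>z. U z - V z) has_derivative (\<lambda>h. (F z - P z) * h + (G z - Q z) * cnj h)) (at z)"
    by (simp add: algebra_simps)
qed (use assms in \<open>auto simp: hpair_def intro!: holomorphic_intros\<close>)

lemma hpair_translate:
  assumes "hpair U F G S"
  shows "hpair (\<lambda>w. U (a + w)) (\<lambda>w. F (a + w)) (\<lambda>w. G (a + w)) ((+) a -` S)"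
  unfolding hpair_def
proof (intro conjI ballI)
  have S: "open S" "F holomorphic_on S" "(\<lambda>z. cnj (G z)) holomorphic_on S"
    using assms by (auto simp: hpair_def)
  show "open ((+) a -` S)" using S by (simp add: continuous_open_vimage)
  have "(+) a holomorphic_on (+) a -` S" by (intro holomorphic_intros)
  note * = holomorphic_on_compose_gen[OF this, where t = S, unfolded o_def]
  show "(\<lambda>w. F (a + w)) holomorphic_on (+) a -` S" "(\<lambda>w. cnj (G (a + w))) holomorphic_on (+) a -` S"
    using *[OF S(2)] *[OF S(3)] by auto
  fix w assume "w \<in> (+) a -` S"
  then have "(U has_derivative (\<lambda>h. F (a + w) * h + G (a + w) * cnj h)) (at (a + w))"
    using assms by (auto simp: hpair_def)
  moreover have "((+) a has_derivative (\<lambda>h. h)) (at w)" by (auto intro!: derivative_eq_intros)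
  ultimately show "((\<lambda>w. U (a + w)) has_derivative (\<lambda>h. F (a + w) * h + G (a + w) * cnj h)) (at w)"
    using has_derivative_compose by blast
qed

lemma hpair_cont:
  assumes "hpair U F G S"
  shows "continuous_on S U" "continuous_on S F" "continuous_on S G"
proof -
  show "continuous_on S U" using assms
    by (auto simp: hpair_def intro!: has_derivative_continuous_on[of S U] intro: has_derivative_at_withinI)
  show "continuous_on S F" using assms by (auto simp: hpair_def holomorphic_on_imp_continuous_on)
  have "continuous_on S (\<lambda>z. cnj (cnj (G z)))"
    using assms by (rule_tac continuous_on_cnj) (auto simp: hpair_def holomorphic_on_imp_continuous_on)
  then show "continuous_on S G" by simp
qed

section \<open>Fourier modes on circles\<close>

text \<open>The \<open>n\<close>-th Fourier coefficient without the factor \<open>1/(2 * pi)\<close>.\<close>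

definition fmode :: "int \<Rightarrow> (real \<Rightarrow> complex) \<Rightarrow> complex" where
  "fmode n g = integral {0..2*pi} (\<lambda>t. g t * cis (- of_int n * t))"

lemma fmode_integrable:
  "continuous_on {0..2*pi} g \<Longrightarrow> (\<lambda>t. g t * cis (- of_int n * t)) integrable_on {0..2*pi}"
  by (intro integrable_continuous_interval continuous_intros)

lemma fmode_add:
  assumes "continuous_on {0..2*pi} g" "continuous_on {0..2*pi} h"
  shows "fmode n (\<lambda>t. g t + h t) = fmode n g + fmode n h"
  unfolding fmode_def distrib_right
  by (rule integral_add) (use assms fmode_integrable in auto)

lemma fmode_diff:
  assumes "continuous_on {0..2*pi} g" "continuous_on {0..2*pi} h"
  shows "fmode n (\<lambda>t. g t - h t) = fmode n g - fmode n h"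
  unfolding fmode_def left_diff_distrib
  by (rule integral_diff) (use assms fmode_integrable in auto)

lemma fmode_cmult: "fmode n (\<lambda>t. c * g t) = c * fmode n g"
  unfolding fmode_def mult.assoc by simp

lemma fmode_cnj: "fmode n (\<lambda>t. cnj (g t)) = cnj (fmode (- n) g)"
  unfolding fmode_def integral_cnj by (simp add: cis_cnj)

lemma fmode_shift: "fmode n (\<lambda>t. rcis r t * g t) = of_real r * fmode (n - 1) g"
proof -
  have *: "rcis r t * g t * cis (- of_int n * t) = of_real r * (g t * cis (- of_int (n - 1) * t))" for t
  proof -
    have "cis t * cis (- of_int n * t) = cis (- of_int (n - 1) * t)"
      by (simp add: cis_mult algebra_simps)
    moreover have "rcis r t * g t * cis (- of_int n * t) = of_real r * (g t * (cis t * cis (- of_int n * t)))"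
      by (simp only: rcis_def mult_ac)
    ultimately show ?thesis by simp
  qed
  show ?thesis unfolding fmode_def * by (rule integral_mult_right)
qed

lemma norm_fmode_le:
  assumes "continuous_on {0..2*pi} g" "\<And>t. norm (g t) \<le> K"
  shows "norm (fmode n g) \<le> 2 * pi * K"
proof -
  have "norm (integral {0..2*pi} (\<lambda>t. g t * cis (- of_int n * t))) \<le> K * (2 * pi - 0)"
    using assms by (intro integral_bound) (auto simp: norm_mult intro!: continuous_intros)
  then show ?thesis unfolding fmode_def by (simp add: mult_ac)
qed

lemma fmode_tendsto:
  assumes u: "uniform_limit {0..2*pi} g h F" and c: "\<forall>\<^sub>F r in F. continuous_on {0..2*pi} (g r)"
    and F: "F \<noteq> bot"
  shows "((\<lambda>r. fmode n (g r)) \<longlongrightarrow> fmode n h) F"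
proof -
  \<comment> \<open>\<open>uniform_limit_integral\<close> wants every member of the family to be
    integrable, while continuity is known only eventually; the exceptional members are replaced by
    0.\<close>
  define g' where "g' = (\<lambda>r. if continuous_on {0..2*pi} (g r) then g r else (\<lambda>t. 0))"
  have e: "\<forall>\<^sub>F r in F. g' r = g r" using c by eventually_elim (simp add: g'_def)
  have ch: "continuous_on {0..2*pi} h" using uniform_limit_theorem[OF c u F] .
  have "uniform_limit {0..2*pi} g' h F"
    unfolding uniform_limit_iff
  proof (intro allI impI)
    fix \<epsilon> :: real assume "\<epsilon> > 0"
    with u have "\<forall>\<^sub>F r in F. \<forall>t\<in>{0..2*pi}. dist (g r t) (h t) < \<epsilon>" by (simp add: uniform_limit_iff)
    with e show "\<forall>\<^sub>F r in F. \<forall>t\<in>{0..2*pi}. dist (g' r t) (h t) < \<epsilon>" by eventually_elim simp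
  qed
  have b: "bounded (h ` {0..2*pi})" using ch compact_continuous_image compact_imp_bounded compact_Icc by blast
  have "uniform_limit {0..2*pi} (\<lambda>r t. g' r t * cis (- of_int n * t)) (\<lambda>t. h t * cis (- of_int n * t)) F"
  proof (rule uniform_lim_mult[OF \<open>uniform_limit {0..2*pi} g' h F\<close> uniform_limit_const b])
    show "bounded ((\<lambda>t. cis (- of_int n * t)) ` {0..2*pi})"
      unfolding bounded_iff by (rule exI[of _ 1]) auto
  qed
  then obtain I J where I: "\<And>r. ((\<lambda>t. g' r t * cis (- of_int n * t)) has_integral I r) {0..2*pi}"
      and J: "((\<lambda>t. h t * cis (- of_int n * t)) has_integral J) {0..2*pi}" "(I \<longlongrightarrow> J) F"
    by (rule uniform_limit_integral) (auto simp: g'_def F intro!: continuous_intros)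
  have "((\<lambda>r. fmode n (g' r)) \<longlongrightarrow> fmode n h) F"
    using J unfolding fmode_def integral_unique[OF I] integral_unique[OF J(1)] by simp
  then show ?thesis
    by (rule Lim_transform_eventually) (use e in eventually_elim, simp)
qed

section \<open>Calculus along circles\<close>

lemma exp_of_real_has_derivative:
  fixes c :: complex
  shows   "((\<lambda>t. exp (c * of_real t)) has_derivative (\<lambda>h. h *\<^sub>R (c * exp (c * of_real t)))) (at t within S)"
proof -
  have "((\<lambda>z. exp (c * z)) has_field_derivative c * exp (c * of_real t)) (at (of_real t))"
    by (auto intro!: derivative_eq_intros)
  from has_vector_derivative_real_field[OF this] show ?thesis
    by (simp add: has_vector_derivative_def)
qed

lemma rcis_has_derivative: "((\<lambda>t. rcis r t) has_derivative (\<lambda>h. h *\<^sub>R (\<i> * rcis r t))) (at t within S)"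
proof -
  have "((\<lambda>t. of_real r * exp (\<i> * of_real t)) has_derivative (\<lambda>h. h *\<^sub>R (\<i> * (of_real r * exp (\<i> * of_real t))))) (at t within S)"
    by (rule has_derivative_eq_rhs[OF has_derivative_mult_right[OF exp_of_real_has_derivative]])
      (simp add: fun_eq_iff scaleR_conv_of_real mult_ac)
  then show ?thesis by (simp add: rcis_def cis_conv_exp)
qed

lemma continuous_on_rcis:
  assumes "continuous_on S f" "sphere 0 r \<subseteq> S" "0 \<le> r"
  shows "continuous_on T (\<lambda>t. f (rcis r t))"
proof (rule continuous_on_compose2[OF assms(1)])
  show "continuous_on T (rcis r)" unfolding rcis_def by (intro continuous_intros)
qed (use assms in auto)

text \<open>This is \<open>r * \<partial>U/\<partial>r\<close> for a function \<open>U\<close> with Wirtinger derivatives \<open>F\<close> and \<open>G\<close>.\<close>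

definition radial :: "(complex \<Rightarrow> complex) \<Rightarrow> (complex \<Rightarrow> complex) \<Rightarrow> real \<Rightarrow> real \<Rightarrow> complex" where
  "radial F G r t = rcis r t * F (rcis r t) + cnj (rcis r t) * G (rcis r t)"

lemma continuous_on_rcis_arg: "continuous_on T (\<lambda>t. rcis r t)"
  unfolding rcis_def by (intro continuous_intros)

lemma continuous_on_radial:
  assumes "hpair U F G S" "sphere 0 r \<subseteq> S" "0 \<le> r"
  shows "continuous_on T (radial F G r)"
  unfolding radial_def
  by (intro continuous_intros continuous_on_rcis_arg continuous_on_rcis[OF hpair_cont(2)[OF assms(1)]]
      continuous_on_rcis[OF hpair_cont(3)[OF assms(1)]] assms)

text \<open>Along the circle the derivative of \<open>U\<close> in \<open>t\<close> is \<i> times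
  the difference of the two products on the right. Integration by parts moves it onto the
  exponential, which yields the factor \<open>n\<close>.\<close>

lemma fmode_by_parts:
  assumes h: "hpair U F G S" and r: "sphere 0 r \<subseteq> S" "0 \<le> r"
  shows "of_int n * fmode n (\<lambda>t. U (rcis r t))
    = fmode n (\<lambda>t. rcis r t * F (rcis r t)) - fmode n (\<lambda>t. cnj (rcis r t) * G (rcis r t))"
proof -
  let ?z = "rcis r" and ?e = "\<lambda>t. cis (- of_int n * t)"
  note cont = continuous_on_rcis[OF hpair_cont(1)[OF h] r, of "{0..2*pi}"]
    continuous_on_rcis[OF hpair_cont(2)[OF h] r, of "{0..2*pi}"]
    continuous_on_rcis[OF hpair_cont(3)[OF h] r, of "{0..2*pi}"] continuous_on_rcis_arg[of "{0..2*pi}" r]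
  have c: "continuous_on {0..2*pi} (\<lambda>t. ?z t * F (?z t))" "continuous_on {0..2*pi} (\<lambda>t. cnj (?z t) * G (?z t))"
    by (rule continuous_on_mult continuous_on_cnj cont)+
  note I1 = has_integral_mult_right[OF integrable_integral[OF fmode_integrable[OF c(1)]]]
    and I2 = has_integral_mult_right[OF integrable_integral[OF fmode_integrable[OF c(2)]]]
    and I3 = has_integral_mult_right[OF integrable_integral[OF fmode_integrable[OF cont(1)]]]
  have "((\<lambda>t. \<i> * (?z t * F (?z t) * ?e t) - \<i> * (cnj (?z t) * G (?z t) * ?e t) - \<i> * of_int n * (U (?z t) * ?e t))
      has_integral (U (?z (2*pi)) * ?e (2*pi) - U (?z 0) * ?e 0)) {0..2*pi}"
  proof (rule fundamental_theorem_of_calculus)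
    fix t :: real
    have "?z t \<in> S" using r by auto
    then have "(U has_derivative (\<lambda>h. F (?z t) * h + G (?z t) * cnj h)) (at (?z t))"
      using h by (auto simp: hpair_def)
    from has_derivative_compose[OF rcis_has_derivative this]
    have 1: "((\<lambda>t. U (?z t)) has_derivative
        (\<lambda>h. F (?z t) * (h *\<^sub>R (\<i> * ?z t)) + G (?z t) * cnj (h *\<^sub>R (\<i> * ?z t)))) (at t within {0..2*pi})" .
    have "((\<lambda>t. exp (- \<i> * of_int n * of_real t)) has_derivative
        (\<lambda>h. h *\<^sub>R (- \<i> * of_int n * exp (- \<i> * of_int n * of_real t)))) (at t within {0..2*pi})"
      by (rule exp_of_real_has_derivative)
    then have 2: "(?e has_derivative (\<lambda>h. h *\<^sub>R (- \<i> * of_int n * ?e t))) (at t within {0..2*pi})"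
      by (simp add: cis_conv_exp mult.assoc)
    show "((\<lambda>t. U (?z t) * ?e t) has_vector_derivative
       \<i> * (?z t * F (?z t) * ?e t) - \<i> * (cnj (?z t) * G (?z t) * ?e t) - \<i> * of_int n * (U (?z t) * ?e t)) (at t within {0..2*pi})"
      unfolding has_vector_derivative_def
      by (rule has_derivative_eq_rhs[OF has_derivative_mult[OF 1 2]])
        (simp add: fun_eq_iff scaleR_conv_of_real algebra_simps)
  qed simp
  \<comment> \<open>As \<open>n\<close> is an integer, the primitive is periodic and the endpoint
    terms cancel.\<close>
  moreover have "?e (2*pi) = 1"
    using cis_multiple_2pi[of "- of_int n"] by (simp add: mult.commute mult.left_commute)
  ultimately have J0: "((\<lambda>t. \<i> * (?z t * F (?z t) * ?e t) - \<i> * (cnj (?z t) * G (?z t) * ?e t) - \<i> * of_int n * (U (?z t) * ?e t))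
      has_integral 0) {0..2*pi}" by (simp add: rcis_def)
  have J1: "((\<lambda>t. \<i> * (?z t * F (?z t) * ?e t) - \<i> * (cnj (?z t) * G (?z t) * ?e t) - \<i> * of_int n * (U (?z t) * ?e t))
      has_integral (\<i> * fmode n (\<lambda>t. ?z t * F (?z t)) - \<i> * fmode n (\<lambda>t. cnj (?z t) * G (?z t))
        - \<i> * of_int n * fmode n (\<lambda>t. U (?z t)))) {0..2*pi}"
    unfolding fmode_def
    by (rule has_integral_diff[OF has_integral_diff[OF I1 I2] I3])
  have "\<i> * fmode n (\<lambda>t. ?z t * F (?z t)) - \<i> * fmode n (\<lambda>t. cnj (?z t) * G (?z t))
        - \<i> * of_int n * fmode n (\<lambda>t. U (?z t)) = 0"
    by (rule has_integral_unique[OF J1 J0])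
  then have "\<i> * (fmode n (\<lambda>t. ?z t * F (?z t)) - fmode n (\<lambda>t. cnj (?z t) * G (?z t))
        - of_int n * fmode n (\<lambda>t. U (?z t))) = 0"
    by (simp only: right_diff_distrib mult.assoc)
  then show ?thesis by simp
qed

section \<open>Modes of holomorphic functions on a disk\<close>

text \<open>Cauchy's formula for the k-th derivative at the centre: on the circle, dz / z^(k+1)
  equals i r^(-k) e^(-ikt) dt.\<close>

lemma fmode_holomorphic:
  fixes f :: "complex \<Rightarrow> complex"
  assumes f: "f holomorphic_on cball 0 r" and r: "0 < r"
  shows "fmode (int k) (\<lambda>t. f (rcis r t)) = 2 * pi * r ^ k * (deriv ^^ k) f 0 / fact k"
proof -
  have "((\<lambda>u. f u / (u - 0) ^ Suc k) has_contour_integral (2 * pi * \<i> / fact k * (deriv ^^ k) f 0)) (circlepath 0 r)"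
    using f r by (intro Cauchy_has_contour_integral_higher_derivative_circlepath)
      (auto intro: holomorphic_on_imp_continuous_on holomorphic_on_subset[OF f])
  then have "((\<lambda>t. f (rcis r t) / rcis r t ^ Suc k * of_real r * \<i> * cis t) has_integral
      (2 * pi * \<i> / fact k * (deriv ^^ k) f 0)) {0..2*pi}"
    using r unfolding circlepath_def
    by (subst (asm) has_contour_integral_part_circlepath_iff) (auto simp: rcis_def)
  moreover have *: "f (rcis r t) / rcis r t ^ Suc k * of_real r * \<i> * cis t
      = \<i> / r ^ k * (f (rcis r t) * cis (- of_int (int k) * t))" for t
  proof -
    have "cis (- of_int (int k) * t) = inverse (cis t ^ k)"
      by (simp add: Complex.DeMoivre flip: cis_inverse)
    then show ?thesis using r by (simp add: rcis_def power_mult_distrib field_simps)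
  qed
  ultimately have **: "((\<lambda>t. \<i> / r ^ k * (f (rcis r t) * cis (- of_int (int k) * t))) has_integral
      (2 * pi * \<i> / fact k * (deriv ^^ k) f 0)) {0..2*pi}" by (simp only: *)
  have "\<i> / r ^ k * fmode (int k) (\<lambda>t. f (rcis r t)) = 2 * pi * \<i> / fact k * (deriv ^^ k) f 0"
    unfolding fmode_def by (rule trans[OF integral_mult_right[symmetric] integral_unique[OF **]])
  then show ?thesis using r by (simp add: field_simps)
qed

text \<open>Multiplication by \<open>z ^ k\<close> with \<open>k = - n\<close> turns the mode into
  mode 0 up to a power of \<open>r\<close>. Mode 0 is a multiple of the value at the centre, where
  \<open>z ^ k\<close> vanishes.\<close>

lemma fmode_holomorphic_neg:
  fixes f :: "complex \<Rightarrow> complex"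
  assumes f: "f holomorphic_on cball 0 r" and r: "0 < r" and n: "n < 0"
  shows "fmode n (\<lambda>t. f (rcis r t)) = 0"
proof -
  define k where "k = nat (- n)"
  have k: "n = - int k" "k > 0" using n by (auto simp: k_def)
  have "fmode (int 0) (\<lambda>t. rcis r t ^ k * f (rcis r t)) = 0"
    using k fmode_holomorphic[of "\<lambda>z. z ^ k * f z" r 0] r by (simp add: holomorphic_intros f)
  moreover have "rcis r t ^ k * f (rcis r t) = r ^ k * (f (rcis r t) * cis (- of_int n * t))" for t
    using k by (simp add: rcis_def power_mult_distrib Complex.DeMoivre)
  ultimately show ?thesis using r by (simp add: fmode_def)
qed

text \<open>The term with \<open>G\<close> is the conjugate of z g(z), so it has no mode of positive
  index, and only z F(z) enters both the radial derivative and \<open>fmode_by_parts\<close>.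
  Agreement with \<open>f\<close> and \<open>g\<close> is asked on the circle only, so that
  \<open>S\<close> may omit the centre, as it does after inversion.\<close>

lemma disc_modes:
  fixes f g :: "complex \<Rightarrow> complex"
  assumes h: "hpair U F G S" and S: "sphere 0 r \<subseteq> S" and r: "0 < r"
    and f: "f holomorphic_on cball 0 r" "\<And>z. z \<in> sphere 0 r \<Longrightarrow> F z = f z"
    and g: "g holomorphic_on cball 0 r" "\<And>z. z \<in> sphere 0 r \<Longrightarrow> cnj (G z) = g z"
  shows "fmode (1 + int k) (radial F G r) = 2 * pi * r ^ Suc k * (deriv ^^ k) f 0 / fact k"
    and "of_nat (Suc k) * fmode (1 + int k) (\<lambda>t. U (rcis r t)) = fmode (1 + int k) (radial F G r)"
proof -
  let ?n = "1 + int k"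
  note cont = continuous_on_rcis[OF hpair_cont(2)[OF h] S, of "{0..2*pi}"]
    continuous_on_rcis[OF hpair_cont(3)[OF h] S, of "{0..2*pi}"] continuous_on_rcis_arg[of "{0..2*pi}" r]
  have sph: "rcis r t \<in> sphere 0 r" for t using r by simp
  have "cnj (rcis r t) * G (rcis r t) = cnj (rcis r t * g (rcis r t))" for t
    using g(2)[OF sph[of t], symmetric] by simp
  then have "fmode ?n (\<lambda>t. cnj (rcis r t) * G (rcis r t)) = cnj (fmode (- ?n) (\<lambda>t. rcis r t * g (rcis r t)))"
    by (simp only: fmode_cnj)
  also have "\<dots> = 0"
    unfolding fmode_shift using fmode_holomorphic_neg[OF g(1) r] by simp
  finally have B: "fmode ?n (\<lambda>t. cnj (rcis r t) * G (rcis r t)) = 0" .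
  have "fmode ?n (\<lambda>t. rcis r t * F (rcis r t)) = r * fmode (int k) (\<lambda>t. f (rcis r t))"
    using f(2)[OF sph] by (simp add: fmode_shift)
  also have "\<dots> = 2 * pi * r ^ Suc k * (deriv ^^ k) f 0 / fact k"
    by (simp add: fmode_holomorphic[OF f(1) r])
  finally have A: "fmode ?n (\<lambda>t. rcis r t * F (rcis r t)) = 2 * pi * r ^ Suc k * (deriv ^^ k) f 0 / fact k" .
  have D: "fmode ?n (radial F G r) = fmode ?n (\<lambda>t. rcis r t * F (rcis r t))"
    unfolding radial_def using r by (subst fmode_add) (auto simp: B intro!: continuous_intros cont)
  show "fmode ?n (radial F G r) = 2 * pi * r ^ Suc k * (deriv ^^ k) f 0 / fact k" using D A by simp
  show "of_nat (Suc k) * fmode ?n (\<lambda>t. U (rcis r t)) = fmode ?n (radial F G r)"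
    using fmode_by_parts[OF h S, of ?n] r D B by simp
qed

text \<open>The first Fourier mode of \<open>U\<close> on the circle is \<open>2 * pi * r * F a\<close>.\<close>

lemma gradient_estimate:
  fixes a :: complex
  assumes h: "hpair U F G S" and S: "cball a r \<subseteq> S" and r: "0 < r"
    and K: "\<And>z. z \<in> sphere a r \<Longrightarrow> norm (U z) \<le> K"
  shows "norm (F a) \<le> K / r"
proof -
  let ?S = "(+) a -` S"
  note h' = hpair_translate[OF h, of a]
  have S': "cball 0 r \<subseteq> ?S"
  proof
    fix w :: complex assume "w \<in> cball 0 r"
    then have "a + w \<in> cball a r" by (simp add: dist_norm)
    then show "w \<in> ?S" using S by auto
  qed
  have sph: "sphere 0 r \<subseteq> ?S" using S' by auto
  have holo: "(\<lambda>w. F (a + w)) holomorphic_on cball 0 r" "(\<lambda>w. cnj (G (a + w))) holomorphic_on cball 0 r"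
    using h' S' by (auto simp: hpair_def intro: holomorphic_on_subset)
  have "fmode 1 (\<lambda>t. U (a + rcis r t)) = 2 * pi * r * F a"
    using disc_modes[OF h' sph r holo(1) _ holo(2), of 0] by simp
  moreover have "norm (fmode 1 (\<lambda>t. U (a + rcis r t))) \<le> 2 * pi * K"
  proof (rule norm_fmode_le)
    show "continuous_on {0..2*pi} (\<lambda>t. U (a + rcis r t))"
      using continuous_on_rcis[OF hpair_cont(1)[OF h'] sph] r by simp
    show "norm (U (a + rcis r t)) \<le> K" for t
      by (rule K) (use r in \<open>simp add: dist_norm\<close>)
  qed
  ultimately show ?thesis using r by (simp add: norm_mult field_simps)
qed

section \<open>Isolated singularities and interior modes\<close>

text \<open>Riemann's theorem on removable singularities needs z F(z) -> 0. The gradient estimate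
  for \<open>U - L\<close> on the disk of radius |z|/2 around z bounds F(z) by o(1) * 2/|z|, which
  is just enough.\<close>

lemma puncture_extension:
  assumes h: "hpair U F G (ball 0 R - {0})" and lim: "(U \<longlongrightarrow> L) (at 0)" and R: "0 < R"
  obtains f where "f holomorphic_on ball 0 R" "\<And>z. z \<in> ball 0 R - {0} \<Longrightarrow> F z = f z"
proof -
  have "hpair (\<lambda>z. L) (\<lambda>z. 0) (\<lambda>z. 0) (ball 0 R - {0})"
    by (auto simp: hpair_def)
  from hpair_diff[OF h this] have h': "hpair (\<lambda>z. U z - L) F G (ball 0 R - {0})" by simp
  have "((\<lambda>z. (z - 0) * F z) \<longlongrightarrow> 0) (at 0)"
  proof (rule tendstoI)
    fix e :: real assume e: "e > 0"
    have "\<forall>\<^sub>F z in at 0. dist (U z) L < e / 4" using tendstoD[OF lim, of "e / 4"] e by simp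
    then obtain d where d: "d > 0" "\<And>z. z \<noteq> 0 \<Longrightarrow> norm z < d \<Longrightarrow> norm (U z - L) < e / 4"
      unfolding eventually_at by (auto simp: dist_norm)
    \<comment> \<open>Points of the disk around z used below have norm less than
      \<open>2 * m\<close>, that is, less than both \<open>d\<close> and \<open>R\<close>.\<close>
    define m where "m = min d R / 2"
    have m: "m > 0" "m < d" "m < R" using d R by (auto simp: m_def min_def)
    have "norm (z * F z) < e" if z: "z \<noteq> 0" "norm z < m" for z
    proof -
      let ?r = "norm z / 2"
      have c: "0 < norm w \<and> norm w < 2 * m" if "w \<in> cball z ?r" for w
      proof -
        have "norm (z - w) \<le> norm z / 2" using that by (simp add: dist_norm)
        moreover have "0 < norm z" using z by simp
        ultimately show ?thesis
          using norm_triangle_ineq2[of z w] norm_triangle_ineq2[of w z] norm_minus_commute[of z w] z(2)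
          by linarith
      qed
      have "norm (F z) \<le> (e / 4) / ?r"
      proof (rule gradient_estimate[OF h'])
        show "cball z ?r \<subseteq> ball 0 R - {0}" using c by (fastforce simp: m_def)
        show "0 < ?r" using z by simp
        fix w assume "w \<in> sphere z ?r"
        then have "0 < norm w \<and> norm w < 2 * m" by (intro c) auto
        then show "norm (U w - L) \<le> e / 4" using d(2)[of w] by (auto simp: m_def)
      qed
      then have "norm (z * F z) \<le> e / 2" using z by (simp add: norm_mult field_simps)
      then show ?thesis using e by simp
    qed
    then show "\<forall>\<^sub>F z in at 0. dist ((z - 0) * F z) 0 < e"
      unfolding eventually_at using m by (intro exI[of _ m]) auto
  qed
  then have "\<exists>f. f holomorphic_on ball 0 R \<and> (\<forall>z\<in>ball 0 R - {0}. f z = F z)"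
    using h R by (subst holomorphic_on_extend_lim) (auto simp: hpair_def)
  then show ?thesis using that by metis
qed

lemma radial_cnj: "radial (\<lambda>z. cnj (G z)) (\<lambda>z. cnj (F z)) r t = cnj (radial F G r t)"
  by (simp add: radial_def add.commute)

text \<open>The disk is punctured because an inverted exterior field is controlled only away from
  0.\<close>

lemma interior_modes:
  assumes h: "hpair U F G (ball 0 R - {0})" and lim: "(U \<longlongrightarrow> L) (at 0)"
    and r: "0 < r" "r < R" and n: "n \<noteq> 0"
  shows "fmode n (radial F G r) = of_int \<bar>n\<bar> * fmode n (\<lambda>t. U (rcis r t))"
proof -
  \<comment> \<open>Stated for arbitrary fields, since a negative index is treated as a positive
    index of the conjugate field.\<close>
  have pos: "fmode n (radial F G r) = of_int n * fmode n (\<lambda>t. U (rcis r t))"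
    if h: "hpair U F G (ball 0 R - {0})" and lim: "(U \<longlongrightarrow> L) (at 0)" and n: "0 < n" for U F G L n
  proof -
    have R: "0 < R" using r by simp
    obtain f where f: "f holomorphic_on ball 0 R" "\<And>z. z \<in> ball 0 R - {0} \<Longrightarrow> F z = f z"
      using puncture_extension[OF h lim R] by blast
    obtain g where g: "g holomorphic_on ball 0 R" "\<And>z. z \<in> ball 0 R - {0} \<Longrightarrow> cnj (G z) = g z"
      using puncture_extension[OF hpair_cnj[OF h] tendsto_cnj[OF lim] R] by blast
    define k where "k = nat (n - 1)"
    have k: "n = 1 + int k" using n by (simp add: k_def)
    have "of_nat (Suc k) * fmode (1 + int k) (\<lambda>t. U (rcis r t)) = fmode (1 + int k) (radial F G r)"
    proof (rule disc_modes(2)[OF h])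
      show "sphere 0 r \<subseteq> ball 0 R - {0}" using r by auto
      show "f holomorphic_on cball 0 r" using r by (intro holomorphic_on_subset[OF f(1)]) auto
      show "g holomorphic_on cball 0 r" using r by (intro holomorphic_on_subset[OF g(1)]) auto
      show "F z = f z" if "z \<in> sphere 0 r" for z using f(2) r that by auto
      show "cnj (G z) = g z" if "z \<in> sphere 0 r" for z using g(2) r that by auto
    qed (use r in auto)
    then show ?thesis by (simp add: k)
  qed
  show ?thesis
  proof (cases "0 < n")
    case True
    then show ?thesis using pos[OF h lim] by simp
  next
    case False
    then have "fmode (- n) (radial (\<lambda>z. cnj (G z)) (\<lambda>z. cnj (F z)) r) = of_int (- n) * fmode (- n) (\<lambda>t. cnj (U (rcis r t)))"
      using n by (intro pos[OF hpair_cnj[OF h] tendsto_cnj[OF lim]]) simp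
    then have "cnj (fmode n (radial F G r)) = cnj (of_int (- n) * fmode n (\<lambda>t. U (rcis r t)))"
      unfolding radial_cnj fmode_cnj by simp
    then show ?thesis using False unfolding complex_cnj_cancel_iff by simp
  qed
qed

text \<open>The mode equals a fixed nonzero multiple of \<open>r ^ Suc k\<close> times the
  derivative of \<open>f\<close>, so its limit at \<open>R > 0\<close> vanishes only if that
  derivative does. This is how boundary information reaches the Taylor coefficients at the
  centre.\<close>

lemma interior_coeff:
  assumes h: "hpair U F G (ball 0 R - {0})" and lim: "(U \<longlongrightarrow> L) (at 0)" and R: "0 < R"
    and f: "f holomorphic_on ball 0 R" "\<And>z. z \<in> ball 0 R - {0} \<Longrightarrow> F z = f z"
    and D: "((\<lambda>r. fmode (1 + int k) (radial F G r)) \<longlongrightarrow> 0) (at_left R)"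
  shows "(deriv ^^ k) f 0 = 0"
proof -
  obtain g where g: "g holomorphic_on ball 0 R" "\<And>z. z \<in> ball 0 R - {0} \<Longrightarrow> cnj (G z) = g z"
    using puncture_extension[OF hpair_cnj[OF h] tendsto_cnj[OF lim] R] by blast
  have e: "2 * pi * r ^ Suc k * (deriv ^^ k) f 0 / fact k = fmode (1 + int k) (radial F G r)"
    if r: "r \<in> {0<..<R}" for r
  proof (rule disc_modes(1)[OF h, symmetric])
    show "sphere 0 r \<subseteq> ball 0 R - {0}" using r by auto
    show "f holomorphic_on cball 0 r" using r by (intro holomorphic_on_subset[OF f(1)]) auto
    show "g holomorphic_on cball 0 r" using r by (intro holomorphic_on_subset[OF g(1)]) auto
    show "F z = f z" if "z \<in> sphere 0 r" for z using f(2) r that by auto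
    show "cnj (G z) = g z" if "z \<in> sphere 0 r" for z using g(2) r that by auto
  qed (use r in auto)
  have "((\<lambda>r. complex_of_real (2 * pi * r ^ Suc k) * (deriv ^^ k) f 0 / fact k) \<longlongrightarrow>
      complex_of_real (2 * pi * R ^ Suc k) * (deriv ^^ k) f 0 / fact k) (at_left R)"
    by (intro tendsto_intros) auto
  moreover have "((\<lambda>r. complex_of_real (2 * pi * r ^ Suc k) * (deriv ^^ k) f 0 / fact k) \<longlongrightarrow> 0) (at_left R)"
    by (rule Lim_transform_eventually[OF D], rule eventually_mono[OF eventually_at_leftI[OF _ R]])
      (use e in auto)
  ultimately have "complex_of_real (2 * pi * R ^ Suc k) * (deriv ^^ k) f 0 / fact k = 0"
    using tendsto_unique trivial_limit_at_left_real by blast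
  then show ?thesis using R by simp
qed

section \<open>Exterior fields by inversion\<close>

text \<open>Reflection in the unit circle is antiholomorphic, so it preserves harmonicity and
  exchanges the roles of \<open>F\<close> and \<open>G\<close>. Unlike 1/w it keeps the angle of a
  point, hence the index of a mode.\<close>

lemma hpair_kelvin:
  assumes h: "hpair U F G (- cball 0 a)" and a: "0 < a"
  shows "hpair (\<lambda>w. U (1 / cnj w)) (\<lambda>w. - G (1 / cnj w) / w\<^sup>2) (\<lambda>w. - F (1 / cnj w) / (cnj w)\<^sup>2)
    (ball 0 (1 / a) - {0})"
proof -
  let ?B = "ball 0 (1 / a) - {0} :: complex set" and ?E = "- cball 0 a :: complex set"
  have E: "1 / cnj w \<in> ?E" if "w \<in> ?B" for w
    using that a by (auto simp: norm_divide field_simps)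
  have E': "1 / w \<in> ?E" if "w \<in> ?B" for w
    using that a by (auto simp: norm_divide field_simps)
  have inv: "(\<lambda>w. 1 / w) holomorphic_on ?B" by (intro holomorphic_intros) auto
  \<comment> \<open>The antiholomorphic substitution is split into
    \<open>cnj \<circ> f \<circ> cnj\<close>, holomorphic because the exterior is invariant under
    conjugation, and the holomorphic map \<open>1 / w\<close>.\<close>
  have hol: "(\<lambda>w. cnj (f (1 / cnj w))) holomorphic_on ?B" if "f holomorphic_on ?E" for f
  proof -
    have "z \<in> cnj ` ?E" if "z \<in> ?E" for z
      using that by (intro image_eqI[of _ _ "cnj z"]) auto
    then have "cnj ` ?E = ?E" by auto
    then have "(cnj \<circ> f \<circ> cnj) holomorphic_on ?E"
      using that by (intro holomorphic_on_compose_cnj_cnj) auto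
    moreover have "(\<lambda>w. 1 / w) ` ?B \<subseteq> ?E" using E' by blast
    ultimately have "(cnj \<circ> f \<circ> cnj) \<circ> (\<lambda>w. 1 / w) holomorphic_on ?B"
      by (rule holomorphic_on_compose_gen[OF inv])
    then show ?thesis by (simp add: o_def)
  qed
  show ?thesis
    unfolding hpair_def
  proof (intro conjI ballI)
    fix w assume w: "w \<in> ?B"
    have "((\<lambda>w. 1 / cnj w) has_derivative (\<lambda>k. - cnj k / (cnj w)\<^sup>2)) (at w)"
      using w by (auto intro!: derivative_eq_intros simp: power2_eq_square divide_simps)
    moreover have "(U has_derivative (\<lambda>k. F (1 / cnj w) * k + G (1 / cnj w) * cnj k)) (at (1 / cnj w))"
      using h E[OF w] by (auto simp: hpair_def)
    ultimately have "((\<lambda>w. U (1 / cnj w)) has_derivative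
      (\<lambda>k. F (1 / cnj w) * (- cnj k / (cnj w)\<^sup>2) + G (1 / cnj w) * cnj (- cnj k / (cnj w)\<^sup>2))) (at w)"
      by (rule has_derivative_compose)
    then show "((\<lambda>w. U (1 / cnj w)) has_derivative
      (\<lambda>k. - G (1 / cnj w) / w\<^sup>2 * k + - F (1 / cnj w) / (cnj w)\<^sup>2 * cnj k)) (at w)"
      by (rule has_derivative_eq_rhs) (simp add: fun_eq_iff algebra_simps)
  next
    have "(\<lambda>w. - cnj (cnj (G (1 / cnj w))) / w\<^sup>2) holomorphic_on ?B"
      by (intro holomorphic_intros hol[of "\<lambda>z. cnj (G z)"]) (use h in \<open>auto simp: hpair_def\<close>)
    then show "(\<lambda>w. - G (1 / cnj w) / w\<^sup>2) holomorphic_on ?B" by simp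
    have "(\<lambda>w. - cnj (F (1 / cnj w)) / w\<^sup>2) holomorphic_on ?B"
      by (intro holomorphic_intros hol) (use h in \<open>auto simp: hpair_def\<close>)
    then show "(\<lambda>w. cnj (- F (1 / cnj w) / (cnj w)\<^sup>2)) holomorphic_on ?B" by simp
  qed auto
qed

lemma kelvin_tendsto:
  fixes U :: "complex \<Rightarrow> complex"
  assumes "(U \<longlongrightarrow> L) at_infinity"
  shows "((\<lambda>w. U (1 / cnj w)) \<longlongrightarrow> L) (at 0)"
proof -
  have "filterlim (\<lambda>w. inverse w) at_infinity (at (0::complex))"
    by (rule filterlim_inverse_at_infinity)
  then have "filterlim (\<lambda>w. 1 / cnj w) at_infinity (at (0::complex))"
    unfolding filterlim_at_infinity_conv_norm_at_top by (simp add: norm_inverse norm_divide inverse_eq_divide)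
  from filterlim_compose[OF assms this] show ?thesis .
qed

lemma rcis_kelvin: "1 / cnj (rcis (1 / r) t) = rcis r t"
  by (simp add: rcis_def cis_cnj flip: cis_inverse) (simp add: field_simps)

text \<open>Reflection reverses the radial direction and r d/dr is invariant under scaling, so only
  the sign changes. The factor is written \<open>- 1 * ...\<close> to match
  \<open>fmode_cmult\<close>.\<close>

lemma radial_kelvin:
  assumes "r \<noteq> 0"
  shows "radial (\<lambda>w. - G (1 / cnj w) / w\<^sup>2) (\<lambda>w. - F (1 / cnj w) / (cnj w)\<^sup>2) (1 / r) = (\<lambda>t. - 1 * radial F G r t)"
proof
  fix t
  let ?z = "rcis (1 / r) t"
  have z: "?z \<noteq> 0" using assms by (simp add: rcis_def)
  have i: "rcis r t = 1 / cnj ?z" "cnj (rcis r t) = 1 / ?z"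
    using rcis_kelvin[of r t] by (auto simp flip: rcis_kelvin[of r t])
  show "radial (\<lambda>w. - G (1 / cnj w) / w\<^sup>2) (\<lambda>w. - F (1 / cnj w) / (cnj w)\<^sup>2) (1 / r) t = - 1 * radial F G r t"
    unfolding radial_def rcis_kelvin using z by (simp add: i power2_eq_square)
qed

lemma exterior_modes:
  assumes h: "hpair U F G (- cball 0 a)" and lim: "(U \<longlongrightarrow> 0) at_infinity"
    and r: "0 < a" "a < r" and n: "n \<noteq> 0"
  shows "fmode n (radial F G r) = - of_int \<bar>n\<bar> * fmode n (\<lambda>t. U (rcis r t))"
proof -
  have "fmode n (\<lambda>t. - 1 * radial F G r t) = of_int \<bar>n\<bar> * fmode n (\<lambda>t. U (rcis r t))"
    using interior_modes[OF hpair_kelvin[OF h r(1)] kelvin_tendsto[OF lim] _ _ n, of "1 / r"] r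
    by (simp only: radial_kelvin rcis_kelvin) (simp add: frac_less2)
  then have "- fmode n (radial F G r) = of_int \<bar>n\<bar> * fmode n (\<lambda>t. U (rcis r t))"
    unfolding fmode_cmult by simp
  then show ?thesis by (metis minus_minus mult_minus_left)
qed

section \<open>Limits at the boundary circle\<close>

text \<open>Uniform convergence of the radial derivative makes \<open>U\<close> Lipschitz along all rays with one
  constant, so the pointwise limits \<open>T\<close> are uniform as well and pass through the Fourier integral.\<close>

lemma boundary_modes:
  fixes U :: "complex \<Rightarrow> complex"
  assumes h: "hpair U F G S" and I: "I = {..<0} \<or> I = {0<..}"
    and d: "0 < d" "d \<le> r0" "\<And>s. s \<in> I \<Longrightarrow> \<bar>s\<bar> < d \<Longrightarrow> sphere 0 (r0 + s) \<subseteq> S"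
    and N: "uniform_limit {0..2*pi} (\<lambda>s t. radial F G (r0 + s) t / of_real (r0 + s)) N (at 0 within I)"
    and T: "\<And>t. ((\<lambda>s. U (rcis (r0 + s) t)) \<longlongrightarrow> T t) (at 0 within I)"
  shows "((\<lambda>s. fmode n (\<lambda>t. U (rcis (r0 + s) t))) \<longlongrightarrow> fmode n T) (at 0 within I)"
    and "((\<lambda>s. fmode n (radial F G (r0 + s))) \<longlongrightarrow> of_real r0 * fmode n N) (at 0 within I)"
    and "continuous_on {0..2*pi} N" and "continuous_on {0..2*pi} T"
proof -
  have nb: "at 0 within I \<noteq> bot" using I by (auto simp: trivial_limit_at_left_real trivial_limit_at_right_real)
  have cI: "convex I" using I by auto
  have near: "\<forall>\<^sub>F s in at 0 within I. s \<in> I \<and> \<bar>s\<bar> < e" if "e > 0" for e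
    using that unfolding eventually_at by (intro exI[of _ e]) (auto simp: dist_norm)
  have cR: "\<forall>\<^sub>F s in at 0 within I. continuous_on {0..2*pi} (radial F G (r0 + s))"
    using near[OF d(1)] by eventually_elim (use d in \<open>auto intro!: continuous_on_radial[OF h]\<close>)
  have cU: "\<forall>\<^sub>F s in at 0 within I. continuous_on {0..2*pi} (\<lambda>t. U (rcis (r0 + s) t))"
    using near[OF d(1)] by eventually_elim (use d in \<open>auto intro!: continuous_on_rcis[OF hpair_cont(1)[OF h]]\<close>)
  have nz: "\<forall>\<^sub>F s in at 0 within I. r0 + s \<noteq> 0"
    using near[OF d(1)] by eventually_elim (use d in auto)
  have cQ: "\<forall>\<^sub>F s in at 0 within I. continuous_on {0..2*pi} (\<lambda>t. radial F G (r0 + s) t / of_real (r0 + s))"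
    using cR nz by eventually_elim (auto intro!: continuous_intros simp del: of_real_add)
  from uniform_limit_theorem[OF cQ N nb] show cN: "continuous_on {0..2*pi} N" .
  have "bounded (N ` {0..2*pi})" using cN compact_continuous_image compact_imp_bounded compact_Icc by blast
  then obtain B where B: "\<And>t. t \<in> {0..2*pi} \<Longrightarrow> norm (N t) \<le> B" unfolding bounded_iff by (metis imageI)
  have "\<forall>\<^sub>F s in at 0 within I. \<forall>t\<in>{0..2*pi}. dist (radial F G (r0 + s) t / of_real (r0 + s)) (N t) < 1"
    using N by (simp add: uniform_limit_iff)
  then obtain e where e: "e > 0" "\<And>s t. s \<in> I \<Longrightarrow> \<bar>s\<bar> < e \<Longrightarrow> t \<in> {0..2*pi} \<Longrightarrow>
      norm (radial F G (r0 + s) t / of_real (r0 + s) - N t) < 1"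
    unfolding eventually_at using I by (auto simp: dist_norm)
  \<comment> \<open>Near the boundary the radial derivative differs from \<open>N\<close> by less
    than 1, and \<open>N\<close> is bounded by \<open>B\<close> as a continuous function on a
    compact interval.\<close>
  define K where "K = \<bar>B\<bar> + 1"
  have K: "K > 0" by (simp add: K_def)
  define c where "c = min d e"
  have c: "c > 0" "c \<le> d" "c \<le> e" using d e by (auto simp: c_def)
  define J where "J = I \<inter> ball 0 c"
  have cJ: "convex J" using cI by (auto simp: J_def intro!: convex_Int)
  have J: "s \<in> I" "\<bar>s\<bar> < c" if "s \<in> J" for s using that by (auto simp: J_def)
  have bound: "norm (radial F G (r0 + s) t / of_real (r0 + s)) \<le> K" if "s \<in> J" "t \<in> {0..2*pi}" for s t
    using e(2)[of s t] B[of t] J[of s] that c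
      norm_triangle_ineq2[of "radial F G (r0 + s) t / of_real (r0 + s)" "N t"] by (simp add: K_def)
  have lip: "norm (U (rcis (r0 + s) t) - U (rcis (r0 + s') t)) \<le> K * norm (s - s')"
    if "s \<in> J" "s' \<in> J" and t: "t \<in> {0..2*pi}" for s s' t
  proof (rule differentiable_bound[OF cJ, of "\<lambda>s. U (rcis (r0 + s) t)" "\<lambda>s k. k *\<^sub>R (radial F G (r0 + s) t / of_real (r0 + s))"])
    fix s assume s: "s \<in> J"
    have "r0 + s > 0" using J[OF s] c d by linarith
    have "rcis (r0 + s) t \<in> S" using J[OF s] d(3)[of s] c \<open>r0 + s > 0\<close> by auto
    then have "(U has_derivative (\<lambda>k. F (rcis (r0 + s) t) * k + G (rcis (r0 + s) t) * cnj k)) (at (rcis (r0 + s) t))"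
      using h by (auto simp: hpair_def)
    moreover have "((\<lambda>s. rcis (r0 + s) t) has_derivative (\<lambda>k. k *\<^sub>R cis t)) (at s within J)"
      unfolding rcis_def by (auto intro!: derivative_eq_intros simp: scaleR_conv_of_real)
    ultimately have "((\<lambda>s. U (rcis (r0 + s) t)) has_derivative
      (\<lambda>k. F (rcis (r0 + s) t) * (k *\<^sub>R cis t) + G (rcis (r0 + s) t) * cnj (k *\<^sub>R cis t))) (at s within J)"
      using has_derivative_compose by blast
    then show "((\<lambda>s. U (rcis (r0 + s) t)) has_derivative
       (\<lambda>k. k *\<^sub>R (radial F G (r0 + s) t / of_real (r0 + s)))) (at s within J)"
    proof (rule has_derivative_eq_rhs)
      have "radial F G (r0 + s) t = of_real (r0 + s) * (F (rcis (r0 + s) t) * cis t + G (rcis (r0 + s) t) * cnj (cis t))"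
        unfolding radial_def rcis_def[of "r0 + s" t] by (simp add: algebra_simps)
      then have "radial F G (r0 + s) t / of_real (r0 + s) = F (rcis (r0 + s) t) * cis t + G (rcis (r0 + s) t) * cnj (cis t)"
        using \<open>r0 + s > 0\<close> by (metis less_irrefl nonzero_mult_div_cancel_left of_real_eq_0_iff)
      then show "(\<lambda>k. F (rcis (r0 + s) t) * (k *\<^sub>R cis t) + G (rcis (r0 + s) t) * cnj (k *\<^sub>R cis t))
        = (\<lambda>k. k *\<^sub>R (radial F G (r0 + s) t / of_real (r0 + s)))"
        by (simp add: fun_eq_iff scaleR_conv_of_real algebra_simps)
    qed
    show "onorm (\<lambda>k. k *\<^sub>R (radial F G (r0 + s) t / of_real (r0 + s))) \<le> K"
       using bound[OF s t] by (intro onorm_le) (simp add: mult.commute[of "\<bar>_\<bar>"] mult_right_mono)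
  qed (use that in auto)
  \<comment> \<open>The Lipschitz bound with the second radius sent to the boundary: this gives a
    rate that does not depend on the angle.\<close>
  have lim: "norm (U (rcis (r0 + s) t) - T t) \<le> K * \<bar>s\<bar>" if s: "s \<in> J" and t: "t \<in> {0..2*pi}" for s t
  proof (rule tendsto_le[OF nb])
    show "((\<lambda>s'. K * norm (s - s')) \<longlongrightarrow> K * \<bar>s\<bar>) (at 0 within I)"
      by (rule tendsto_eq_intros | simp)+
    show "((\<lambda>s'. norm (U (rcis (r0 + s) t) - U (rcis (r0 + s') t))) \<longlongrightarrow> norm (U (rcis (r0 + s) t) - T t)) (at 0 within I)"
      by (intro tendsto_intros T)
    show "\<forall>\<^sub>F s' in at 0 within I. norm (U (rcis (r0 + s) t) - U (rcis (r0 + s') t)) \<le> K * norm (s - s')"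
      using near[OF c(1)] by eventually_elim (use lip s t in \<open>auto simp: J_def\<close>)
  qed
  have uT: "uniform_limit {0..2*pi} (\<lambda>s t. U (rcis (r0 + s) t)) T (at 0 within I)"
    unfolding uniform_limit_iff
  proof (intro allI impI)
    fix \<epsilon> :: real assume "\<epsilon> > 0"
    then have "\<epsilon> / K > 0" using K by simp
    from near[OF this] near[OF c(1)]
    show "\<forall>\<^sub>F s in at 0 within I. \<forall>t\<in>{0..2*pi}. dist (U (rcis (r0 + s) t)) (T t) < \<epsilon>"
    proof eventually_elim
      case (elim s)
      have "s \<in> J" using elim by (simp add: J_def)
      moreover have "K * \<bar>s\<bar> < \<epsilon>" using elim K by (simp add: field_simps)
      ultimately show ?case using lim by (fastforce simp: dist_norm)
    qed
  qed
  show "continuous_on {0..2*pi} T" by (rule uniform_limit_theorem[OF cU uT nb])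
  show "((\<lambda>s. fmode n (\<lambda>t. U (rcis (r0 + s) t))) \<longlongrightarrow> fmode n T) (at 0 within I)"
    by (rule fmode_tendsto[OF uT cU nb])
  \<comment> \<open>\<open>N\<close> is the limit of the plain radial derivative, while
    \<open>radial\<close> carries a factor of the radius, which is restored here.\<close>
  from fmode_tendsto[OF N cQ nb, of n]
  have "((\<lambda>s. of_real (r0 + s) * fmode n (\<lambda>t. radial F G (r0 + s) t / of_real (r0 + s))) \<longlongrightarrow> of_real (r0 + 0) * fmode n N) (at 0 within I)"
    by (intro tendsto_intros)
  then have *: "((\<lambda>s. of_real (r0 + s) * fmode n (\<lambda>t. radial F G (r0 + s) t / of_real (r0 + s))) \<longlongrightarrow> of_real r0 * fmode n N) (at 0 within I)"
    by simp
  show "((\<lambda>s. fmode n (radial F G (r0 + s))) \<longlongrightarrow> of_real r0 * fmode n N) (at 0 within I)"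
  proof (rule Lim_transform_eventually[OF *])
    show "\<forall>\<^sub>F s in at 0 within I. of_real (r0 + s) * fmode n (\<lambda>t. radial F G (r0 + s) t / of_real (r0 + s)) = fmode n (radial F G (r0 + s))"
      using nz by eventually_elim (simp add: fmode_cmult[symmetric] del: of_real_add)
  qed
qed

section \<open>Fields determined by their boundary modes\<close>

text \<open>Integration by parts for a constant field leaves \<open>n\<close> times the mode equal
  to 0.\<close>

lemma fmode_const:
  assumes "n \<noteq> 0"
  shows "fmode n (\<lambda>t. c) = 0"
  using fmode_by_parts[of "\<lambda>_. c" "\<lambda>_. 0" "\<lambda>_. 0" UNIV 1 n] assms
  by (auto simp: hpair_def fmode_def)

lemma fmode_cis:
  assumes "n \<noteq> k"
  shows "fmode n (\<lambda>t. c * cis (of_int k * t)) = 0"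
proof -
  have *: "c * cis (of_int k * t) * cis (- of_int n * t) = c * cis (- of_int (n - k) * t)" for t
  proof -
    have "cis (of_int k * t) * cis (- of_int n * t) = cis (- of_int (n - k) * t)"
      by (simp add: cis_mult algebra_simps)
    then show ?thesis by (simp only: mult.assoc)
  qed
  have "fmode (n - k) (\<lambda>t. c) = 0" using assms by (intro fmode_const) simp
  then show ?thesis unfolding fmode_def * .
qed

lemma holomorphic_linear_bound:
  assumes "f holomorphic_on ball 0 R" "0 < R" "f 0 = (0::complex)"
  obtains C d where "0 < C" "0 < d" "\<And>w. norm w < d \<Longrightarrow> norm (f w) \<le> C * norm w"
proof -
  obtain f' where "(f has_field_derivative f') (at 0)"
    using assms(1,2) holomorphic_derivI[of f "ball 0 R" 0] by auto
  then have "(f has_derivative (*) f') (at 0)" by (simp add: has_field_derivative_def)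
  then obtain d where d: "d > 0" "\<And>w. norm (w - 0) < d \<Longrightarrow> norm (f w - f 0 - f' * (w - 0)) \<le> 1 * norm (w - 0)"
    unfolding has_derivative_at_alt by (metis zero_less_one)
  have "norm (f w) \<le> (norm f' + 1) * norm w" if "norm w < d" for w
    using d(2)[of w] that assms(3) norm_triangle_ineq2[of "f w" "f' * w"]
    by (simp add: norm_mult algebra_simps)
  then show ?thesis using that[of "norm f' + 1" d] d(1) by (simp add: add_nonneg_pos)
qed

text \<open>The modes 1 and -1 determine the values at 0 of the extensions of \<open>F\<close> and
  of the conjugate of \<open>G\<close>. Once these vanish, the gradient is O(|w|), and integrating
  it along the segment from 0 to w gives O(|w|^2).\<close>

lemma quadratic_decay:
  fixes U :: "complex \<Rightarrow> complex"
  assumes h: "hpair U F G (ball 0 R - {0})" and lim: "(U \<longlongrightarrow> 0) (at 0)" and R: "0 < R"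
    and D: "((\<lambda>r. fmode 1 (radial F G r)) \<longlongrightarrow> 0) (at_left R)"
           "((\<lambda>r. fmode (- 1) (radial F G r)) \<longlongrightarrow> 0) (at_left R)"
  obtains C d where "0 < d" "\<And>w. w \<noteq> 0 \<Longrightarrow> norm w < d \<Longrightarrow> norm (U w) \<le> C * (norm w)\<^sup>2"
proof -
  have bound: "\<exists>C d. 0 < C \<and> 0 < d \<and> (\<forall>w. w \<noteq> 0 \<longrightarrow> norm w < d \<longrightarrow> norm (F w) \<le> C * norm w)"
    if h: "hpair U F G (ball 0 R - {0})" and lim: "(U \<longlongrightarrow> 0) (at 0)"
    and D: "((\<lambda>r. fmode 1 (radial F G r)) \<longlongrightarrow> 0) (at_left R)" for U F G
  proof -
    obtain f where f: "f holomorphic_on ball 0 R" "\<And>z. z \<in> ball 0 R - {0} \<Longrightarrow> F z = f z"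
      using puncture_extension[OF h lim R] by blast
    \<comment> \<open>Index 1 is the case \<open>k = 0\<close>, where the vanishing derivative is
      the value of \<open>f\<close> itself.\<close>
    have "f 0 = 0" using interior_coeff[OF h lim R f, of 0] D by simp
    then obtain C d where C: "0 < C" "0 < d" "\<And>w. norm w < d \<Longrightarrow> norm (f w) \<le> C * norm w"
      using holomorphic_linear_bound[OF f(1) R] by blast
    then have "norm (F w) \<le> C * norm w" if "w \<noteq> 0" "norm w < min d R" for w
      using f(2)[of w] that by auto
    then show ?thesis using C R by (intro exI[of _ C] exI[of _ "min d R"]) auto
  qed
  obtain C1 d1 where 1: "0 < C1" "0 < d1" "\<And>w. w \<noteq> 0 \<Longrightarrow> norm w < d1 \<Longrightarrow> norm (F w) \<le> C1 * norm w"
    using bound[OF h lim D(1)] by blast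
  have "((\<lambda>r. fmode 1 (radial (\<lambda>z. cnj (G z)) (\<lambda>z. cnj (F z)) r)) \<longlongrightarrow> 0) (at_left R)"
    using tendsto_cnj[OF D(2)] unfolding radial_cnj[abs_def] fmode_cnj by simp
  then obtain C2 d2 where 2: "0 < C2" "0 < d2" "\<And>w. w \<noteq> 0 \<Longrightarrow> norm w < d2 \<Longrightarrow> norm (cnj (G w)) \<le> C2 * norm w"
    using bound[OF hpair_cnj[OF h]] tendsto_cnj[OF lim] by auto
  define d where "d = min R (min d1 d2)"
  have d: "0 < d" using 1 2 R by (simp add: d_def)
  have "norm (U w) \<le> (C1 + C2) * (norm w)\<^sup>2" if w: "w \<noteq> 0" "norm w < d" for w
  proof -
    \<comment> \<open>The segment is half-open because nothing is known about \<open>U\<close> at 0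
      except its limit, which enters afterwards by letting \<open>s\<close> tend to 0.\<close>
    have lip: "norm (U (1 *\<^sub>R w) - U (s *\<^sub>R w)) \<le> ((C1 + C2) * (norm w)\<^sup>2) * norm (1 - s)" if s: "s \<in> {0<..1}" for s :: real
    proof (rule differentiable_bound[of "{0<..1}" "\<lambda>s. U (s *\<^sub>R w)" "\<lambda>s k. k *\<^sub>R (F (s *\<^sub>R w) * w + G (s *\<^sub>R w) * cnj w)"])
      fix s :: real assume s: "s \<in> {0<..1}"
      let ?y = "s *\<^sub>R w"
      have ny: "norm ?y \<le> norm w" "?y \<noteq> 0" using s w by (auto simp: mult_left_le_one_le)
      then have nd: "norm ?y < d" using w by linarith
      then have "?y \<in> ball 0 R - {0}" using ny by (simp add: d_def)
      then have "(U has_derivative (\<lambda>k. F ?y * k + G ?y * cnj k)) (at ?y)"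
        using h by (auto simp: hpair_def)
      moreover have "((\<lambda>s. s *\<^sub>R w) has_derivative (\<lambda>k. k *\<^sub>R w)) (at s within {0<..1})"
        by (auto intro!: derivative_eq_intros)
      ultimately have "((\<lambda>s. U (s *\<^sub>R w)) has_derivative (\<lambda>k. F ?y * (k *\<^sub>R w) + G ?y * cnj (k *\<^sub>R w))) (at s within {0<..1})"
        using has_derivative_compose by blast
      then show "((\<lambda>s. U (s *\<^sub>R w)) has_derivative (\<lambda>k. k *\<^sub>R (F ?y * w + G ?y * cnj w))) (at s within {0<..1})"
        by (rule has_derivative_eq_rhs) (simp add: fun_eq_iff scaleR_conv_of_real algebra_simps)
      have "norm (F ?y * w + G ?y * cnj w) \<le> norm (F ?y) * norm w + norm (G ?y) * norm w"
        using norm_triangle_ineq[of "F ?y * w" "G ?y * cnj w"] by (simp add: norm_mult)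
      also have "\<dots> \<le> (C1 * norm w) * norm w + (C2 * norm w) * norm w"
      proof (intro add_mono mult_right_mono)
        have "norm (F ?y) \<le> C1 * norm ?y" using 1(3)[OF ny(2)] nd by (simp add: d_def)
        also have "\<dots> \<le> C1 * norm w" using ny(1) 1(1) by (intro mult_left_mono) auto
        finally show "norm (F ?y) \<le> C1 * norm w" .
        have "norm (G ?y) \<le> C2 * norm ?y" using 2(3)[OF ny(2)] nd by (simp add: d_def)
        also have "\<dots> \<le> C2 * norm w" using ny(1) 2(1) by (intro mult_left_mono) auto
        finally show "norm (G ?y) \<le> C2 * norm w" .
      qed auto
      finally have "norm (F ?y * w + G ?y * cnj w) \<le> (C1 + C2) * (norm w)\<^sup>2"
        by (simp add: algebra_simps power2_eq_square)
      then show "onorm (\<lambda>k. k *\<^sub>R (F ?y * w + G ?y * cnj w)) \<le> (C1 + C2) * (norm w)\<^sup>2"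
        by (intro onorm_le) (simp add: mult.commute[of "\<bar>_\<bar>"] mult_right_mono)
    qed (use s in auto)
    have "norm (U w - 0) \<le> (C1 + C2) * (norm w)\<^sup>2"
    proof (rule tendsto_le[of "at_right (0::real)"])
      have "filterlim (\<lambda>s. s *\<^sub>R w) (at 0) (at_right 0)"
        unfolding filterlim_at
      proof
        show "\<forall>\<^sub>F s in at_right 0. s *\<^sub>R w \<in> UNIV \<and> s *\<^sub>R w \<noteq> 0"
          using w by (auto simp: eventually_at_right_field intro!: exI[of _ 1])
        have "((\<lambda>s. s *\<^sub>R w) \<longlongrightarrow> 0 *\<^sub>R w) (at_right 0)" by (intro tendsto_intros)
        then show "((\<lambda>s. s *\<^sub>R w) \<longlongrightarrow> 0) (at_right 0)" by simp
      qed
      then have "((\<lambda>s. U (s *\<^sub>R w)) \<longlongrightarrow> 0) (at_right 0)"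
        using filterlim_compose[OF lim] by blast
      then show "((\<lambda>s. norm (U w - U (s *\<^sub>R w))) \<longlongrightarrow> norm (U w - 0)) (at_right 0)"
        by (intro tendsto_intros)
      have nn: "0 \<le> (C1 + C2) * (norm w)\<^sup>2" using 1 2 by simp
      have "norm (U w - U (s *\<^sub>R w)) \<le> (C1 + C2) * (norm w)\<^sup>2" if "0 < s" "s < 1" for s
        using lip[of s] that mult_left_le[OF _ nn, of "norm (1 - s)"] by auto
      then show "\<forall>\<^sub>F s in at_right 0. norm (U w - U (s *\<^sub>R w)) \<le> (C1 + C2) * (norm w)\<^sup>2"
        unfolding eventually_at_right_field by (intro exI[of _ 1]) auto
    qed auto
    then show ?thesis by simp
  qed
  then show ?thesis using that d by blast
qed

text \<open>Inversion turns \<open>at_right a\<close> into \<open>at_left (1 / a)\<close>, and a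
  bound C |w|^2 at w = 1/cnj z is a bound C / |z|^2.\<close>

lemma exterior_decay:
  fixes U :: "complex \<Rightarrow> complex"
  assumes h: "hpair U F G (- cball 0 a)" and lim: "(U \<longlongrightarrow> 0) at_infinity" and a: "0 < a"
    and D: "((\<lambda>r. fmode 1 (radial F G r)) \<longlongrightarrow> 0) (at_right a)"
           "((\<lambda>r. fmode (- 1) (radial F G r)) \<longlongrightarrow> 0) (at_right a)"
  obtains C b where "\<And>z. b < norm z \<Longrightarrow> norm (U z) \<le> C / (norm z)\<^sup>2"
proof -
  let ?F = "\<lambda>w. - G (1 / cnj w) / w\<^sup>2" and ?G = "\<lambda>w. - F (1 / cnj w) / (cnj w)\<^sup>2"
  have R: "0 < 1 / a" using a by simp
  have fl: "filterlim (\<lambda>\<rho>. 1 / \<rho>) (at_right a) (at_left (1 / a))"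
  proof (rule tendsto_imp_filterlim_at_right)
    have "((\<lambda>\<rho>. 1 / \<rho>) \<longlongrightarrow> 1 / (1 / a)) (at_left (1 / a))"
      using a by (intro tendsto_intros) auto
    then show "((\<lambda>\<rho>. 1 / \<rho>) \<longlongrightarrow> a) (at_left (1 / a))" by simp
    show "\<forall>\<^sub>F \<rho> in at_left (1 / a). a < 1 / \<rho>"
      by (rule eventually_at_leftI[OF _ R]) (use a in \<open>auto simp: field_simps\<close>)
  qed
  have D': "((\<lambda>\<rho>. fmode n (radial ?F ?G \<rho>)) \<longlongrightarrow> 0) (at_left (1 / a))"
    if "((\<lambda>r. fmode n (radial F G r)) \<longlongrightarrow> 0) (at_right a)" for n
  proof (rule Lim_transform_eventually)
    show "((\<lambda>\<rho>. - 1 * fmode n (radial F G (1 / \<rho>))) \<longlongrightarrow> 0) (at_left (1 / a))"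
      using tendsto_mult_right_zero[OF filterlim_compose[OF that fl]] .
    show "\<forall>\<^sub>F \<rho> in at_left (1 / a). - 1 * fmode n (radial F G (1 / \<rho>)) = fmode n (radial ?F ?G \<rho>)"
    proof (rule eventually_at_leftI[OF _ R])
      fix \<rho> assume "\<rho> \<in> {0<..<1 / a}"
      then show "- 1 * fmode n (radial F G (1 / \<rho>)) = fmode n (radial ?F ?G \<rho>)"
        using radial_kelvin[of "1 / \<rho>" G F] fmode_cmult[of n "- 1" "radial F G (1 / \<rho>)"] by simp
    qed
  qed
  obtain C d where C: "0 < d" "\<And>w. w \<noteq> 0 \<Longrightarrow> norm w < d \<Longrightarrow> norm (U (1 / cnj w)) \<le> C * (norm w)\<^sup>2"
    using quadratic_decay[OF hpair_kelvin[OF h a] kelvin_tendsto[OF lim] R D'[OF D(1)] D'[OF D(2)]] by blast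
  have "norm (U z) \<le> C / (norm z)\<^sup>2" if z: "1 / d < norm z" for z
  proof -
    have "0 < 1 / d" using C(1) by simp
    then have z0: "norm z > 0" using z by linarith
    then have "norm (1 / cnj z) < d" using z C(1) by (simp add: norm_divide field_simps)
    then show ?thesis using C(2)[of "1 / cnj z"] z0 by (auto simp: norm_divide power_divide)
  qed
  then show ?thesis using that by blast
qed

text \<open>Mode \<open>1 + k\<close> carries the k-th Taylor coefficient of \<open>F\<close>, so
  the modes from 2 on are exactly the coefficients with \<open>k > 0\<close>. Their vanishing makes
  \<open>F\<close> constant, and conjugation does the same for \<open>G\<close>.\<close>

lemma interior_affine:
  assumes h: "hpair U F G (ball 0 R)" and R: "0 < R"
    and D: "\<And>n. 2 \<le> \<bar>n\<bar> \<Longrightarrow> ((\<lambda>r. fmode n (radial F G r)) \<longlongrightarrow> 0) (at_left R)"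
  obtains p q c where "\<And>z. z \<in> ball 0 R \<Longrightarrow> U z = p * z + q * cnj z + c"
    "\<And>z. z \<in> ball 0 R \<Longrightarrow> F z = p" "\<And>z. z \<in> ball 0 R \<Longrightarrow> G z = q"
proof -
  have const: "F z = F 0" if h: "hpair U F G (ball 0 R)"
    and D: "\<And>n. 2 \<le> n \<Longrightarrow> ((\<lambda>r. fmode n (radial F G r)) \<longlongrightarrow> 0) (at_left R)" and z: "z \<in> ball 0 R" for U F G z
  proof (rule holomorphic_fun_eq_const_on_connected[of F "ball 0 R"])
    have h': "hpair U F G (ball 0 R - {0})" using hpair_subset[OF h] by (simp add: open_delete)
    have "isCont U 0" using hpair_cont(1)[OF h] R by (simp add: continuous_on_eq_continuous_at)
    then have L: "(U \<longlongrightarrow> U 0) (at 0)" by (simp add: isCont_def)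
    show F: "F holomorphic_on ball 0 R" using h by (simp add: hpair_def)
    show "(deriv ^^ k) F 0 = 0" if "0 < k" for k
      by (rule interior_coeff[OF h' L R F]) (use D that in auto)
  qed (use R z in auto)
  have F: "F z = F 0" if "z \<in> ball 0 R" for z
    using const[OF h D that] by simp
  have "((\<lambda>r. fmode n (radial (\<lambda>z. cnj (G z)) (\<lambda>z. cnj (F z)) r)) \<longlongrightarrow> 0) (at_left R)" if "2 \<le> n" for n
    using tendsto_cnj[OF D[of "- n"]] that unfolding radial_cnj[abs_def] fmode_cnj by simp
  then have "cnj (G z) = cnj (G 0)" if "z \<in> ball 0 R" for z
    using const[OF hpair_cnj[OF h] _ that] by simp
  then have G: "G z = G 0" if "z \<in> ball 0 R" for z using that by simp
  have "((\<lambda>z. U z - (F 0 * z + G 0 * cnj z)) has_derivative (\<lambda>h. 0)) (at z within ball 0 R)" if "z \<in> ball 0 R" for z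
  proof -
    have "(U has_derivative (\<lambda>h. F z * h + G z * cnj h)) (at z)"
      using h that unfolding hpair_def by blast
    then have "(U has_derivative (\<lambda>h. F 0 * h + G 0 * cnj h)) (at z within ball 0 R)"
      unfolding F[OF that] G[OF that] by (rule has_derivative_at_withinI)
    then show ?thesis by (auto intro!: derivative_eq_intros)
  qed
  from has_derivative_zero_constant[OF convex_ball this]
  obtain c where "\<And>z. z \<in> ball 0 R \<Longrightarrow> U z - (F 0 * z + G 0 * cnj z) = c" by blast
  then have "U z = F 0 * z + G 0 * cnj z + c" if "z \<in> ball 0 R" for z using that by (simp add: algebra_simps)
  then show ?thesis using that F G by blast
qed

section \<open>Boundary geometry of the disk\<close>

text \<open>If \<open>n\<close> differs from the radial direction \<open>\<nu>\<close>, the ray from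
  \<open>x\<close> along \<open>e = \<nu> - n\<close> points inwards with respect to
  \<open>n\<close>, so the cone condition puts its initial part into the disk; but it points
  outwards with respect to \<open>\<nu>\<close>, so the norm grows along it.\<close>

lemma is_outward_normal_ball:
  fixes x :: "real^2"
  assumes r: "0 < r" "norm x = r" and n: "is_outward_normal (ball 0 r) x n"
  shows "n = x /\<^sub>R r"
proof (rule ccontr)
  define \<nu> where "\<nu> = x /\<^sub>R r"
  assume "n \<noteq> x /\<^sub>R r"
  define e where "e = \<nu> - n"
  have e: "norm e > 0" using \<open>n \<noteq> x /\<^sub>R r\<close> by (simp add: e_def \<nu>_def)
  have \<nu>: "norm \<nu> = 1" "x = r *\<^sub>R \<nu>" using r by (auto simp: \<nu>_def)
  have nn: "norm n = 1" using n by (simp add: is_outward_normal_def)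
  define c where "c = 1 - \<nu> \<bullet> n"
  have sq: "\<nu> \<bullet> \<nu> = 1" "n \<bullet> n = 1" using \<nu>(1) nn by (auto simp: norm_eq_1)
  have "(norm e)\<^sup>2 = 2 * c"
    unfolding power2_norm_eq_inner e_def c_def using sq by (simp add: inner_diff inner_commute)
  moreover have "(norm e)\<^sup>2 > 0" using e by simp
  ultimately have c: "c > 0" by simp
  have en: "e \<bullet> n = - c" "x \<bullet> e = r * c"
    unfolding e_def c_def \<nu>(2) using sq by (auto simp: inner_diff inner_commute)
  \<comment> \<open>With this aperture the ray along \<open>e\<close> lies exactly on the boundary
    of the closed cone in the definition.\<close>
  have ce: "c / norm e > 0" using c e by simp
  have "\<forall>\<epsilon>>0. \<exists>\<delta>>0. \<forall>y. 0 < dist y x \<and> dist y x < \<delta> \<longrightarrow>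
        ((y - x) \<bullet> n \<le> - \<epsilon> * dist y x \<longrightarrow> y \<in> ball 0 r) \<and>
        ((y - x) \<bullet> n \<ge> \<epsilon> * dist y x \<longrightarrow> y \<notin> closure (ball 0 r))"
    using n unfolding is_outward_normal_def by (rule conjunct2)
  from this[rule_format, OF ce] obtain \<delta> where \<delta>0: "\<delta> > 0" and \<delta>1: "\<forall>y. 0 < dist y x \<and> dist y x < \<delta> \<longrightarrow>
        ((y - x) \<bullet> n \<le> - (c / norm e) * dist y x \<longrightarrow> y \<in> ball 0 r) \<and>
        ((y - x) \<bullet> n \<ge> c / norm e * dist y x \<longrightarrow> y \<notin> closure (ball 0 r))"
    by (elim exE conjE)
  have \<delta>: "y \<in> ball 0 r" if "0 < dist y x" "dist y x < \<delta>" "(y - x) \<bullet> n \<le> - (c / norm e) * dist y x" for y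
    using \<delta>1[rule_format, OF conjI[OF that(1,2)]] that(3) by (elim conjE mp)
  define t where "t = \<delta> / (2 * norm e)"
  have t: "t > 0" using \<delta>0 e by (simp add: t_def)
  let ?y = "x + t *\<^sub>R e"
  have dist: "dist ?y x = \<delta> / 2" using e \<delta>0 by (simp add: dist_norm t_def)
  have xx: "x \<bullet> x = r * r" using r(2) by (simp add: dot_square_norm power2_eq_square)
  have "?y \<in> ball 0 r"
  proof (rule \<delta>)
    show "(?y - x) \<bullet> n \<le> - (c / norm e) * dist ?y x"
      unfolding dist using e by (simp add: en t_def mult.commute)
  qed (use dist \<delta>0 in auto)
  then have "(norm ?y)\<^sup>2 < r\<^sup>2" by (simp add: power_strict_mono)
  moreover have "(norm ?y)\<^sup>2 = r\<^sup>2 + 2 * t * (r * c) + t\<^sup>2 * (norm e)\<^sup>2"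
    unfolding power2_norm_eq_inner en(2)[symmetric]
    by (simp add: inner_add inner_commute[of e x] power2_eq_square distrib_left xx)
  moreover have "0 < 2 * t * (r * c)" using t r c by simp
  moreover have "0 \<le> t\<^sup>2 * (norm e)\<^sup>2" by simp
  ultimately show False by linarith
qed

text \<open>The normal is a definite description: uniqueness is the previous lemma, existence comes
  from the domain condition.\<close>

lemma outward_normal_ball:
  fixes x :: "real^2"
  assumes "0 < r" "norm x = r" "C1_bounded_domain (ball 0 r)"
  shows "outward_normal (ball 0 r) x = x /\<^sub>R r"
proof -
  have "\<exists>n. is_outward_normal (ball 0 r) x n"
    using assms by (auto simp: C1_bounded_domain_def)
  then show ?thesis unfolding outward_normal_def
    using is_outward_normal_ball[OF assms(1,2)] by (metis theI')
qed

lemma outward_normal_plane: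
  assumes "0 < r" "C1_bounded_domain (ball 0 r)"
  shows "outward_normal (ball 0 r) (plane (rcis r t)) = plane (cis t)"
proof -
  have "outward_normal (ball 0 r) (plane (rcis r t)) = plane (rcis r t) /\<^sub>R r"
    using assms by (intro outward_normal_ball) auto
  also have "\<dots> = plane (cis t)"
    using assms by (simp add: vec_eq_iff forall_2)
  finally show ?thesis .
qed

lemma frechet_hpair:
  assumes h: "hpair (u \<circ> plane) F G S" and z: "z \<in> S"
  shows "frechet_derivative u (at (plane z)) (plane k) = F z * k + G z * cnj k"
proof -
  have "((u \<circ> plane) has_derivative (\<lambda>k. F z * k + G z * cnj k)) (at (cplx (plane z)))"
    using h z by (auto simp: hpair_def)
  from has_derivative_compose[OF bounded_linear_imp_has_derivative[OF bounded_linear_cplx] this]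
  have "(u has_derivative (\<lambda>k. F z * cplx k + G z * cnj (cplx k))) (at (plane z))"
    by (simp add: o_def)
  from frechet_derivative_at[OF this] show ?thesis by (metis plane_cplx(2))
qed

text \<open>A shift by \<open>s\<close> along the normal leads to the circle of radius
  \<open>r + s\<close> at the same angle.\<close>

lemma offset_normal_deriv_plane:
  assumes h: "hpair (u \<circ> plane) F G S" and r: "0 < r" "C1_bounded_domain (ball 0 r)"
    and s: "0 < r + s" "sphere 0 (r + s) \<subseteq> S"
  shows "offset_normal_deriv (ball 0 r) u s (plane (rcis r t)) = radial F G (r + s) t / of_real (r + s)"
proof -
  have p: "plane (rcis r t) + s *\<^sub>R plane (cis t) = plane (rcis (r + s) t)"
    by (simp add: vec_eq_iff forall_2 algebra_simps)
  have "rcis (r + s) t \<in> S" using s by auto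
  then have "offset_normal_deriv (ball 0 r) u s (plane (rcis r t))
      = F (rcis (r + s) t) * cis t + G (rcis (r + s) t) * cnj (cis t)"
    unfolding offset_normal_deriv_def outward_normal_plane[OF r] p by (intro frechet_hpair[OF h])
  moreover have "radial F G (r + s) t = of_real (r + s) * (F (rcis (r + s) t) * cis t + G (rcis (r + s) t) * cnj (cis t))"
    unfolding radial_def rcis_def[of "r + s" t] by (simp add: algebra_simps)
  ultimately show ?thesis using s(1) by (metis less_irrefl nonzero_mult_div_cancel_left of_real_eq_0_iff)
qed

text \<open>Translates boundary values into limits over concentric circles, for both sides at once:
  \<open>A\<close> is the disk or its exterior, according to the sign of the offsets in
  \<open>I\<close>.\<close>

lemma side_limits:
  assumes h: "hpair (u \<circ> plane) F G (- sphere 0 r)" and r: "0 < r" "C1_bounded_domain (ball 0 r)"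
    and I: "I = {..<0} \<or> I = {0<..}"
    and N: "uniform_limit (frontier (ball 0 r)) (offset_normal_deriv (ball 0 r) u) N (at 0 within I)"
    and T: "\<And>x. x \<in> frontier (ball 0 r) \<Longrightarrow> (u \<longlongrightarrow> T x) (at x within A)"
    and A: "\<And>s t. s \<in> I \<Longrightarrow> \<bar>s\<bar> < r \<Longrightarrow> plane (rcis (r + s) t) \<in> A"
  defines "N' \<equiv> \<lambda>t. N (plane (rcis r t))" and "T' \<equiv> \<lambda>t. T (plane (rcis r t))"
  shows "((\<lambda>s. fmode n (\<lambda>t. (u \<circ> plane) (rcis (r + s) t))) \<longlongrightarrow> fmode n T') (at 0 within I)"
    and "((\<lambda>s. fmode n (radial F G (r + s))) \<longlongrightarrow> of_real r * fmode n N') (at 0 within I)"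
    and "continuous_on {0..2*pi} N'" and "continuous_on {0..2*pi} T'"
proof -
  have near: "\<forall>\<^sub>F s in at 0 within I. s \<in> I \<and> \<bar>s\<bar> < r"
    using r unfolding eventually_at by (intro exI[of _ r]) (auto simp: dist_norm)
  have pos: "0 < r + s" "sphere 0 (r + s) \<subseteq> - sphere 0 r" if "s \<in> I" "\<bar>s\<bar> < r" for s
    using I that by auto
  have fr: "plane (rcis r t) \<in> frontier (ball 0 r)" for t using r by simp
  have uN: "uniform_limit {0..2*pi} (\<lambda>s t. radial F G (r + s) t / of_real (r + s)) N' (at 0 within I)"
    unfolding uniform_limit_iff
  proof (intro allI impI)
    fix e :: real assume "e > 0"
    then have "\<forall>\<^sub>F s in at 0 within I. \<forall>x\<in>frontier (ball 0 r). dist (offset_normal_deriv (ball 0 r) u s x) (N x) < e"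
      using N by (simp add: uniform_limit_iff)
    then show "\<forall>\<^sub>F s in at 0 within I. \<forall>t\<in>{0..2*pi}. dist (radial F G (r + s) t / of_real (r + s)) (N' t) < e"
      using near
    proof eventually_elim
      case (elim s)
      show ?case
      proof
        fix t
        show "dist (radial F G (r + s) t / of_real (r + s)) (N' t) < e"
          using elim(1)[rule_format, OF fr[of t]] offset_normal_deriv_plane[OF h r pos[of s]] elim(2)
          by (simp add: N'_def del: of_real_add)
      qed
    qed
  qed
  have tT: "((\<lambda>s. (u \<circ> plane) (rcis (r + s) t)) \<longlongrightarrow> T' t) (at 0 within I)" for t
  proof -
    have "filterlim (\<lambda>s. plane (rcis (r + s) t)) (at (plane (rcis r t)) within A) (at 0 within I)"
      unfolding filterlim_at
    proof
      have "plane (rcis (r + s) t) \<noteq> plane (rcis r t)" if "s \<in> I" "\<bar>s\<bar> < r" for s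
        using pos[OF that] that I r norm_plane[of "rcis (r + s) t"] norm_plane[of "rcis r t"] by (auto simp del: norm_plane)
      then show "\<forall>\<^sub>F s in at 0 within I. plane (rcis (r + s) t) \<in> A \<and> plane (rcis (r + s) t) \<noteq> plane (rcis r t)"
        by (intro eventually_mono[OF near]) (use A in blast)
      have "((\<lambda>s. rcis (r + s) t) \<longlongrightarrow> rcis (r + 0) t) (at 0 within I)"
        unfolding rcis_def by (intro tendsto_intros)
      from bounded_linear.tendsto[OF bounded_linear_plane this]
      show "((\<lambda>s. plane (rcis (r + s) t)) \<longlongrightarrow> plane (rcis r t)) (at 0 within I)" by simp
    qed
    from filterlim_compose[OF T[OF fr] this] show ?thesis by (simp add: T'_def)
  qed
  note bm = boundary_modes[OF h I r(1) order_refl _ uN tT]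
  show "((\<lambda>s. fmode n (\<lambda>t. (u \<circ> plane) (rcis (r + s) t))) \<longlongrightarrow> fmode n T') (at 0 within I)"
    by (rule bm(1)) (use pos in blast)
  show "((\<lambda>s. fmode n (radial F G (r + s))) \<longlongrightarrow> of_real r * fmode n N') (at 0 within I)"
    by (rule bm(2)) (use pos in blast)
  show "continuous_on {0..2*pi} N'" by (rule bm(3)) (use pos in blast)
  show "continuous_on {0..2*pi} T'" by (rule bm(4)) (use pos in blast)
qed

section \<open>Tangential derivatives on the circle\<close>

text \<open>The derivative is defined through some arc in the boundary. If \<open>f\<close> agrees
  there with a function differentiable in the plane, the chain rule gives the same value for every
  arc, so the definite description is determined.\<close>

lemma tangential_deriv_eq:
  assumes x: "x \<in> frontier D" and f: "\<And>y. y \<in> frontier D \<Longrightarrow> f y = h y"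
    and h: "(h has_derivative h') (at x)" and ex: "\<exists>d. has_tangential_deriv D f d x"
  shows "tangential_deriv D f x = h' (unit_tangent D x)"
proof -
  have uniq: "d = h' (unit_tangent D x)" if d: "has_tangential_deriv D f d x" for d
  proof -
    obtain \<gamma> where \<gamma>: "boundary_arc D x \<gamma>" and fd: "((\<lambda>s. f (\<gamma> s)) has_vector_derivative d) (at 0)"
      using d by (auto simp: has_tangential_deriv_def)
    then obtain \<delta> where \<delta>: "\<delta> > 0" "\<And>s. \<bar>s\<bar> < \<delta> \<Longrightarrow> \<gamma> s \<in> frontier D"
      "\<And>s. \<bar>s\<bar> < \<delta> \<Longrightarrow> (\<gamma> has_vector_derivative unit_tangent D (\<gamma> s)) (at s)" and g0: "\<gamma> 0 = x"
      by (auto simp: boundary_arc_def)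
    have "(\<gamma> has_derivative (\<lambda>k. k *\<^sub>R unit_tangent D x)) (at 0)"
      using \<delta>(1) \<delta>(3)[of 0] g0 by (simp add: has_vector_derivative_def)
    moreover have "(h has_derivative h') (at (\<gamma> 0))" using h g0 by simp
    ultimately have "((\<lambda>s. h (\<gamma> s)) has_derivative (\<lambda>k. h' (k *\<^sub>R unit_tangent D x))) (at 0)"
      by (rule has_derivative_compose)
    then have hd: "((\<lambda>s. h (\<gamma> s)) has_vector_derivative h' (unit_tangent D x)) (at 0)"
      using has_derivative_linear[OF h] by (simp add: has_vector_derivative_def linear_scale)
    have "((\<lambda>s. f (\<gamma> s)) has_vector_derivative h' (unit_tangent D x)) (at 0)"
      by (rule has_vector_derivative_transform_within_open[OF hd, of "ball 0 \<delta>"])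
        (use \<delta> f in \<open>auto simp: dist_norm\<close>)
    with fd show ?thesis using vector_derivative_unique_at by blast
  qed
  show ?thesis unfolding tangential_deriv_def
    using ex uniq by (metis theI')
qed

lemma unit_tangent_ball:
  assumes "0 < r" "C1_bounded_domain (ball 0 r)"
  shows "unit_tangent (ball 0 r) (plane (rcis r t)) = plane (\<i> * cis t)"
  unfolding unit_tangent_def outward_normal_plane[OF assms] by (simp add: vec_eq_iff forall_2)

lemma tangential_deriv_ball:
  assumes r: "0 < r" "C1_bounded_domain (ball 0 r)"
    and f: "\<And>y. y \<in> frontier (ball 0 r) \<Longrightarrow> f y = h (cplx y)"
    and h: "(h has_derivative h') (at (rcis r t))" and ex: "tangentially_differentiable (ball 0 r) f"
  shows "tangential_deriv (ball 0 r) f (plane (rcis r t)) = h' (\<i> * cis t)"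
proof -
  have "((\<lambda>y. h (cplx y)) has_derivative (\<lambda>k. h' (cplx k))) (at (plane (rcis r t)))"
    using has_derivative_compose[OF bounded_linear_imp_has_derivative[OF bounded_linear_cplx], of h h' "plane (rcis r t)"] h
    by simp
  moreover have "plane (rcis r t) \<in> frontier (ball 0 r)" using r by simp
  ultimately show ?thesis
    using tangential_deriv_eq[of "plane (rcis r t)" "ball 0 r" f "\<lambda>y. h (cplx y)" "\<lambda>k. h' (cplx k)"] f ex
    by (simp add: unit_tangent_ball[OF r] tangentially_differentiable_def)
qed

section \<open>Boundary modes of the transmission problem\<close>

lemma at_left_to_0:
  fixes a :: real
  shows "at_left a = filtermap (\<lambda>x. x + a) (at_left 0)"
proof -
  have "filtermap (\<lambda>x. x - d) (at_left b) = at_left (b - d)" for b d :: real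
    by (simp add: filter_eq_iff eventually_filtermap eventually_at_filter filtermap_nhds_shift[symmetric])
  from this[of "- a" 0] show ?thesis by simp
qed

lemma filterlim_at_left_to_0:
  fixes a :: real
  shows "filterlim f F (at_left a) \<longleftrightarrow> filterlim (\<lambda>x. f (a + x)) F (at_left 0)"
  unfolding filterlim_def filtermap_filtermap at_left_to_0[of a] by (simp add: add.commute)

lemma inside_boundary_modes:
  fixes u :: "real^2 \<Rightarrow> complex" and r :: real
  defines "D \<equiv> ball 0 r"
  assumes h: "hpair (u \<circ> plane) F G (- sphere 0 r)" and r: "0 < r" "C1_bounded_domain D"
    and bv: "has_boundary_values D u"
  defines "N \<equiv> \<lambda>t. normal_deriv_in D u (plane (rcis r t))" and "T \<equiv> \<lambda>t. trace_in D u (plane (rcis r t))"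
  shows "n \<noteq> 0 \<Longrightarrow> of_real r * fmode n N = of_int \<bar>n\<bar> * fmode n T"
    and "((\<lambda>\<rho>. fmode n (radial F G \<rho>)) \<longlongrightarrow> of_real r * fmode n N) (at_left r)"
    and "continuous_on {0..2*pi} N" and "continuous_on {0..2*pi} T"
proof -
  have uN: "uniform_limit (frontier (ball 0 r)) (offset_normal_deriv (ball 0 r) u) (normal_deriv_in (ball 0 r) u) (at_left 0)"
    and tT: "\<And>x. x \<in> frontier (ball 0 r) \<Longrightarrow> (u \<longlongrightarrow> trace_in (ball 0 r) u x) (at x within ball 0 r)"
    using bv by (auto simp: has_boundary_values_def D_def)
  have A: "plane (rcis (r + s) t) \<in> ball 0 r" if "s \<in> {..<0}" "\<bar>s\<bar> < r" for s t
    using that by auto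
  note sl = side_limits[OF h r(1) r(2)[unfolded D_def] disjI1[OF refl] uN tT]
  show "continuous_on {0..2*pi} N" unfolding N_def D_def by (rule sl(3)) (use A in auto)
  show "continuous_on {0..2*pi} T" unfolding T_def D_def by (rule sl(4)) (use A in auto)
  have limT: "((\<lambda>s. fmode n (\<lambda>t. (u \<circ> plane) (rcis (r + s) t))) \<longlongrightarrow> fmode n T) (at_left 0)" for n
    unfolding T_def D_def by (rule sl(1)) (use A in auto)
  have limN: "((\<lambda>s. fmode n (radial F G (r + s))) \<longlongrightarrow> of_real r * fmode n N) (at_left 0)" for n
    unfolding N_def D_def by (rule sl(2)) (use A in auto)
  show "((\<lambda>\<rho>. fmode n (radial F G \<rho>)) \<longlongrightarrow> of_real r * fmode n N) (at_left r)"
    using limN unfolding filterlim_at_left_to_0[of _ _ r] .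
  assume n: "n \<noteq> 0"
  have "ball 0 r \<subseteq> - sphere 0 r" by auto
  from hpair_subset[OF h open_ball this] have hb: "hpair (u \<circ> plane) F G (ball 0 r)" .
  have "isCont (u \<circ> plane) 0" using hpair_cont(1)[OF hb] r
    by (metis centre_in_ball continuous_on_eq_continuous_at open_ball)
  then have L: "((u \<circ> plane) \<longlongrightarrow> (u \<circ> plane) 0) (at 0)" by (simp add: isCont_def)
  have hb': "hpair (u \<circ> plane) F G (ball 0 r - {0})" using hpair_subset[OF hb] by (simp add: open_delete)
  have "- r < 0" using r by simp
  from eventually_at_leftI[OF _ this]
  have "\<forall>\<^sub>F s in at_left 0. fmode n (radial F G (r + s)) = of_int \<bar>n\<bar> * fmode n (\<lambda>t. (u \<circ> plane) (rcis (r + s) t))"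
    using interior_modes[OF hb' L _ _ n] by auto
  then have "((\<lambda>s. of_int \<bar>n\<bar> * fmode n (\<lambda>t. (u \<circ> plane) (rcis (r + s) t))) \<longlongrightarrow> of_real r * fmode n N) (at_left 0)"
    by (rule Lim_transform_eventually[OF limN])
  moreover have "((\<lambda>s. of_int \<bar>n\<bar> * fmode n (\<lambda>t. (u \<circ> plane) (rcis (r + s) t))) \<longlongrightarrow> of_int \<bar>n\<bar> * fmode n T) (at_left 0)"
    by (intro tendsto_intros limT)
  ultimately show "of_real r * fmode n N = of_int \<bar>n\<bar> * fmode n T"
    using tendsto_unique trivial_limit_at_left_real by blast
qed

text \<open>\<open>exterior_modes\<close> needs a field that vanishes at infinity, so the background
  \<open>V\<close> is subtracted. At an index where \<open>V\<close> has no mode on any circle, the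
  subtraction leaves the modes of \<open>u\<close> unchanged.\<close>

lemma outside_boundary_modes:
  fixes u :: "real^2 \<Rightarrow> complex" and r :: real
  defines "D \<equiv> ball 0 r"
  assumes h: "hpair (u \<circ> plane) F G (- sphere 0 r)" and r: "0 < r" "C1_bounded_domain D"
    and bv: "has_boundary_values D u"
    and b: "hpair V P Q UNIV" and lim: "((\<lambda>z. (u \<circ> plane) z - V z) \<longlongrightarrow> 0) at_infinity"
  defines "N \<equiv> \<lambda>t. normal_deriv_out D u (plane (rcis r t))" and "T \<equiv> \<lambda>t. trace_out D u (plane (rcis r t))"
  shows "n \<noteq> 0 \<Longrightarrow> (\<And>\<rho>. fmode n (radial P Q \<rho>) = 0) \<Longrightarrow> (\<And>\<rho>. fmode n (\<lambda>t. V (rcis \<rho> t)) = 0) \<Longrightarrow>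
      of_real r * fmode n N = - of_int \<bar>n\<bar> * fmode n T"
    and "((\<lambda>\<rho>. fmode n (radial F G \<rho>)) \<longlongrightarrow> of_real r * fmode n N) (at_right r)"
    and "continuous_on {0..2*pi} N" and "continuous_on {0..2*pi} T"
proof -
  have uN: "uniform_limit (frontier (ball 0 r)) (offset_normal_deriv (ball 0 r) u) (normal_deriv_out (ball 0 r) u) (at_right 0)"
    and tT: "\<And>x. x \<in> frontier (ball 0 r) \<Longrightarrow> (u \<longlongrightarrow> trace_out (ball 0 r) u x) (at x within - closure (ball 0 r))"
    using bv by (auto simp: has_boundary_values_def D_def)
  have A: "plane (rcis (r + s) t) \<in> - closure (ball 0 r)" if "s \<in> {0<..}" "\<bar>s\<bar> < r" for s t
    using that r by auto
  note sl = side_limits[OF h r(1) r(2)[unfolded D_def] disjI2[OF refl] uN tT]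
  show "continuous_on {0..2*pi} N" unfolding N_def D_def by (rule sl(3)) (use A in auto)
  show cT: "continuous_on {0..2*pi} T" unfolding T_def D_def by (rule sl(4)) (use A in auto)
  have limT: "((\<lambda>s. fmode n (\<lambda>t. (u \<circ> plane) (rcis (r + s) t))) \<longlongrightarrow> fmode n T) (at_right 0)" for n
    unfolding T_def D_def by (rule sl(1)) (use A in auto)
  have limN: "((\<lambda>s. fmode n (radial F G (r + s))) \<longlongrightarrow> of_real r * fmode n N) (at_right 0)" for n
    unfolding N_def D_def by (rule sl(2)) (use A in auto)
  show "((\<lambda>\<rho>. fmode n (radial F G \<rho>)) \<longlongrightarrow> of_real r * fmode n N) (at_right r)"
    using limN unfolding filterlim_at_right_to_0[of _ _ r] by (simp add: add.commute)
  assume n: "n \<noteq> 0" and D0: "\<And>\<rho>. fmode n (radial P Q \<rho>) = 0" and M0: "\<And>\<rho>. fmode n (\<lambda>t. V (rcis \<rho> t)) = 0"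
  have "- cball 0 r \<subseteq> - sphere 0 r" by auto
  from hpair_subset[OF h _ this] have hu: "hpair (u \<circ> plane) F G (- cball 0 r)" by auto
  have hV: "hpair V P Q (- cball 0 r)" using hpair_subset[OF b] by auto
  have e: "fmode n (radial F G \<rho>) = - of_int \<bar>n\<bar> * fmode n (\<lambda>t. (u \<circ> plane) (rcis \<rho> t))" if \<rho>: "r < \<rho>" for \<rho>
  proof -
    have sph: "sphere 0 \<rho> \<subseteq> - cball 0 r" "0 \<le> \<rho>" using \<rho> r by auto
    have "radial (\<lambda>z. F z - P z) (\<lambda>z. G z - Q z) \<rho> = (\<lambda>t. radial F G \<rho> t - radial P Q \<rho> t)"
      by (simp add: fun_eq_iff radial_def algebra_simps)
    then have "fmode n (radial (\<lambda>z. F z - P z) (\<lambda>z. G z - Q z) \<rho>) = fmode n (radial F G \<rho>)"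
      by (simp add: fmode_diff continuous_on_radial[OF hu sph] continuous_on_radial[OF hV sph] D0)
    moreover have "fmode n (\<lambda>t. (u \<circ> plane) (rcis \<rho> t) - V (rcis \<rho> t)) = fmode n (\<lambda>t. (u \<circ> plane) (rcis \<rho> t))"
      by (simp only: fmode_diff continuous_on_rcis[OF hpair_cont(1)[OF hu] sph] continuous_on_rcis[OF hpair_cont(1)[OF hV] sph] M0 diff_zero)
    ultimately show ?thesis
      using exterior_modes[OF hpair_diff[OF hu hV] lim r(1) \<rho> n] by simp
  qed
  have "\<forall>\<^sub>F s in at_right 0. fmode n (radial F G (r + s)) = - of_int \<bar>n\<bar> * fmode n (\<lambda>t. (u \<circ> plane) (rcis (r + s) t))"
    unfolding eventually_at_right_field using e by (intro exI[of _ 1]) auto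
  then have "((\<lambda>s. - of_int \<bar>n\<bar> * fmode n (\<lambda>t. (u \<circ> plane) (rcis (r + s) t))) \<longlongrightarrow> of_real r * fmode n N) (at_right 0)"
    by (rule Lim_transform_eventually[OF limN])
  moreover have "((\<lambda>s. - of_int \<bar>n\<bar> * fmode n (\<lambda>t. (u \<circ> plane) (rcis (r + s) t))) \<longlongrightarrow> - of_int \<bar>n\<bar> * fmode n T) (at_right 0)"
    by (intro tendsto_intros limT)
  ultimately show "of_real r * fmode n N = - of_int \<bar>n\<bar> * fmode n T"
    using tendsto_unique trivial_limit_at_right_real by blast
qed

lemma frontier_ball_plane:
  assumes "0 < r" "x \<in> frontier (ball (0::real^2) r)"
  obtains t where "x = plane (rcis r t)"
proof
  have "norm (cplx x) = r" using assms norm_plane[of "cplx x"] by simp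
  then show "x = plane (rcis r (Arg (cplx x)))" using rcis_cmod_Arg[of "cplx x"] by simp
qed

lemma plane_at_infinity: "filterlim plane at_infinity at_infinity"
  unfolding filterlim_at_infinity_conv_norm_at_top norm_plane by (rule filterlim_norm_at_top)

lemma fmode_cis_pair:
  assumes "n \<noteq> k" "n \<noteq> - k"
  shows "fmode n (\<lambda>t. a * cis (of_int k * t) + b * cis (- of_int k * t)) = 0"
proof -
  have "fmode n (\<lambda>t. a * cis (of_int k * t) + b * cis (of_int (- k) * t)) = 0"
    using assms by (subst fmode_add) (auto simp: fmode_cis intro!: continuous_intros simp del: of_int_minus)
  then show ?thesis by simp
qed

text \<open>The sources depend on the fundamental field only through these boundary data;
  \<open>p\<close> and \<open>q\<close> are its constant Wirtinger derivatives in the disk.\<close>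

lemma interior_field_affine:
  fixes r :: real and u H :: "real^2 \<Rightarrow> complex"
  defines "D \<equiv> ball 0 r"
  assumes r: "0 < r" "C1_bounded_domain D" and \<epsilon>: "\<epsilon> \<noteq> -1"
    and H: "H = (\<lambda>x. complex_of_real (- E * x $ 1))"
    and harm: "harmonic_on u (- frontier D)" and bv: "has_boundary_values D u"
    and tr: "\<And>x. x \<in> frontier D \<Longrightarrow> trace_out D u x = trace_in D u x"
    and nd: "\<And>x. x \<in> frontier D \<Longrightarrow> normal_deriv_out D u x = \<epsilon> * normal_deriv_in D u x"
    and inf: "(\<lambda>x. u x - H x) \<in> O[at_infinity](\<lambda>x. complex_of_real (1 / norm x))"
  obtains p q c where "\<And>t. normal_deriv_in D u (plane (rcis r t)) = p * cis t + q * cis (- t)"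
    and "\<And>x. x \<in> frontier D \<Longrightarrow> trace_in D u x = p * cplx x + q * cnj (cplx x) + c"
proof -
  have fr: "frontier D = sphere 0 r" using r by (simp add: D_def)
  have vim: "plane -` (- frontier D) = - sphere 0 r" by (auto simp: fr)
  obtain F G where h: "hpair (u \<circ> plane) F G (- sphere 0 r)"
    using harmonic_hpair[OF harm] unfolding vim by blast
  have pf: "plane (rcis r t) \<in> frontier D" for t using r by (simp add: fr)
  \<comment> \<open>Since 2 Re z = z + cnj z, the background -E Re z has both Wirtinger derivatives
    equal to -E/2.\<close>
  define e where "e = complex_of_real (- E / 2)"
  define V where "V = (\<lambda>z. e * z + e * cnj z)"
  have hV: "hpair V (\<lambda>z. e) (\<lambda>z. e) UNIV"
    unfolding hpair_def V_def by (auto intro!: derivative_eq_intros)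
  have VH: "H (plane z) = V z" for z
    unfolding H V_def distrib_left[symmetric] complex_add_cnj e_def by simp
  have lim: "((\<lambda>z. (u \<circ> plane) z - V z) \<longlongrightarrow> 0) at_infinity"
  proof -
    obtain C where C: "\<forall>\<^sub>F x in at_infinity. norm (u x - H x) \<le> C * norm (complex_of_real (1 / norm x))"
      using inf by (auto elim!: landau_o.bigE)
    have "((\<lambda>x::real^2. C * inverse (norm x)) \<longlongrightarrow> C * 0) at_infinity"
      by (intro tendsto_intros tendsto_inverse_0_at_top filterlim_norm_at_top)
    then have "((\<lambda>x. u x - H x) \<longlongrightarrow> 0) at_infinity"
      by (intro Lim_null_comparison[OF C]) (simp add: norm_divide inverse_eq_divide)
    from filterlim_compose[OF this plane_at_infinity] show ?thesis by (simp add: VH)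
  qed
  have D0: "fmode n (\<lambda>t. V (rcis \<rho> t)) = 0" "fmode n (radial (\<lambda>z. e) (\<lambda>z. e) \<rho>) = 0" if "2 \<le> \<bar>n\<bar>" for n \<rho>
  proof -
    have 1: "V (rcis \<rho> t) = (e * \<rho>) * cis (of_int 1 * t) + (e * \<rho>) * cis (- of_int 1 * t)" for t
      by (simp add: V_def rcis_def cis_cnj)
    have 2: "radial (\<lambda>z. e) (\<lambda>z. e) \<rho> = (\<lambda>t. V (rcis \<rho> t))"
      by (simp add: fun_eq_iff radial_def V_def mult.commute)
    show *: "fmode n (\<lambda>t. V (rcis \<rho> t)) = 0"
      unfolding 1 using that by (intro fmode_cis_pair) auto
    show "fmode n (radial (\<lambda>z. e) (\<lambda>z. e) \<rho>) = 0" unfolding 2 by (rule *)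
  qed
  note ib = inside_boundary_modes[OF h r(1) r(2)[unfolded D_def] bv[unfolded D_def]]
  note ob = outside_boundary_modes[OF h r(1) r(2)[unfolded D_def] bv[unfolded D_def] hV lim]
  let ?N = "\<lambda>t. normal_deriv_in D u (plane (rcis r t))" and ?T = "\<lambda>t. trace_in D u (plane (rcis r t))"
  have N0: "fmode n ?N = 0" if n: "2 \<le> \<bar>n\<bar>" for n
  proof -
    have "of_real r * fmode n ?N = of_int \<bar>n\<bar> * fmode n ?T"
      using ib(1)[of n] n by (auto simp: D_def)
    moreover have "of_real r * fmode n (\<lambda>t. normal_deriv_out D u (plane (rcis r t)))
        = - of_int \<bar>n\<bar> * fmode n (\<lambda>t. trace_out D u (plane (rcis r t)))"
      unfolding D_def by (rule ob(1)) (use n D0 in auto)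
    then have "of_real r * (\<epsilon> * fmode n ?N) = - of_int \<bar>n\<bar> * fmode n ?T"
      by (simp only: tr[OF pf] nd[OF pf] fmode_cmult)
    \<comment> \<open>The inner and outer relations have opposite signs, so adding them eliminates
      the trace.\<close>
    ultimately have "of_real r * ((1 + \<epsilon>) * fmode n ?N) = 0" by (simp add: algebra_simps)
    moreover have "1 + \<epsilon> \<noteq> 0" using \<epsilon> by (simp add: add_eq_0_iff)
    ultimately show ?thesis using r by simp
  qed
  have "ball 0 r \<subseteq> - sphere 0 r" by auto
  from hpair_subset[OF h open_ball this] have hb: "hpair (u \<circ> plane) F G (ball 0 r)" .
  have "((\<lambda>\<rho>. fmode n (radial F G \<rho>)) \<longlongrightarrow> 0) (at_left r)" if "2 \<le> \<bar>n\<bar>" for n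
    using ib(2)[of n] N0[OF that] by (simp add: D_def)
  from interior_affine[OF hb r(1) this] obtain p q c where
    U: "\<And>z. z \<in> ball 0 r \<Longrightarrow> (u \<circ> plane) z = p * z + q * cnj z + c" and
    FG: "\<And>z. z \<in> ball 0 r \<Longrightarrow> F z = p" "\<And>z. z \<in> ball 0 r \<Longrightarrow> G z = q" by blast
  \<comment> \<open>On every smaller circle the normal derivative already has the asserted value, so
    the limit is that of a constant.\<close>
  have "?N t = p * cis t + q * cis (- t)" for t
  proof -
    have "((\<lambda>s. offset_normal_deriv D u s (plane (rcis r t))) \<longlongrightarrow> ?N t) (at_left 0)"
      using bv pf by (auto simp: has_boundary_values_def intro: tendsto_uniform_limitI)
    moreover have "offset_normal_deriv D u s (plane (rcis r t)) = p * cis t + q * cis (- t)" if s: "s \<in> {- r<..<0}" for s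
    proof -
      have rs: "0 < r + s" "r + s < r" "sphere 0 (r + s) \<subseteq> - sphere 0 r" using s by auto
      have "rcis (r + s) t \<in> ball 0 r" using rs by simp
      then have "radial F G (r + s) t = of_real (r + s) * (p * cis t + q * cis (- t))"
        unfolding radial_def by (simp only: FG) (simp add: rcis_def cis_cnj algebra_simps)
      moreover have "complex_of_real (r + s) \<noteq> 0" using rs(1) by (simp del: of_real_add)
      ultimately show ?thesis
        using offset_normal_deriv_plane[OF h r(1) r(2)[unfolded D_def] rs(1,3)] unfolding D_def
        by (metis nonzero_mult_div_cancel_left)
    qed
    then have "\<forall>\<^sub>F s in at_left 0. offset_normal_deriv D u s (plane (rcis r t)) = p * cis t + q * cis (- t)"
      using r by (intro eventually_at_leftI[of "- r"]) auto
    ultimately have "((\<lambda>s. p * cis t + q * cis (- t)) \<longlongrightarrow> ?N t) (at_left (0::real))"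
      by (rule Lim_transform_eventually)
    then show ?thesis using tendsto_const_iff trivial_limit_at_left_real by metis
  qed
  moreover have "trace_in D u x = p * cplx x + q * cnj (cplx x) + c" if x: "x \<in> frontier D" for x
  proof (rule tendsto_unique)
    have "x islimpt D" using x r by (simp add: fr D_def islimpt_ball)
    then show "at x within D \<noteq> bot" by (simp add: trivial_limit_within)
    show "(u \<longlongrightarrow> trace_in D u x) (at x within D)" using bv x by (simp add: has_boundary_values_def)
    have "((\<lambda>y. p * cplx y + q * cnj (cplx y) + c) \<longlongrightarrow> p * cplx x + q * cnj (cplx x) + c) (at x within D)"
      by (intro tendsto_intros bounded_linear.tendsto[OF bounded_linear_cplx])
    moreover have "\<forall>\<^sub>F y in at x within D. p * cplx y + q * cnj (cplx y) + c = u y"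
      unfolding eventually_at_filter
    proof (intro always_eventually allI impI)
      fix y assume "y \<in> D"
      then have "cplx y \<in> ball 0 r" using norm_plane[of "cplx y"] by (simp add: D_def)
      then show "p * cplx y + q * cnj (cplx y) + c = u y" using U[of "cplx y"] by simp
    qed
    ultimately show "(u \<longlongrightarrow> p * cplx x + q * cnj (cplx x) + c) (at x within D)"
      by (rule Lim_transform_eventually)
  qed
  ultimately show ?thesis using that by blast
qed

section \<open>The second harmonic field of the disk\<close>

theorem theorem5p1:
  fixes r\<^sub>0 E :: real
    and \<epsilon>\<omega> \<epsilon>2\<omega> \<chi>perp \<chi>par :: complex
    and \<Omega> :: "(real^2) set"
    and H u\<omega> u2\<omega> :: "real^2 \<Rightarrow> complex"
  assumes "r\<^sub>0 > 0" and "E > 0"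
    and "\<epsilon>\<omega> \<noteq> -1" and "\<epsilon>2\<omega> \<noteq> -1"
    and "\<Omega> = {x. norm x < r\<^sub>0}"
    and "H = (\<lambda>x. complex_of_real (- E * x $ 1))"
    and "shg_system \<Omega> \<epsilon>\<omega> \<epsilon>2\<omega> \<chi>perp \<chi>par H u\<omega> u2\<omega>"
  shows "u2\<omega> \<in> O[at_infinity](\<lambda>x. complex_of_real (1 / norm x ^ 2))"
proof -
  define D where "D = ball (0::real^2) r\<^sub>0"
  have "\<Omega> = D" using assms(5) by (auto simp: D_def)
  note r = assms(1)
  have shg: "shg_system D \<epsilon>\<omega> \<epsilon>2\<omega> \<chi>perp \<chi>par H u\<omega> u2\<omega>" using assms(7) \<open>\<Omega> = D\<close> by simp
  have C1: "C1_bounded_domain D"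
    and h1: "harmonic_on u\<omega> (- frontier D)" and h2: "harmonic_on u2\<omega> (- frontier D)"
    and bv1: "has_boundary_values D u\<omega>" and bv2: "has_boundary_values D u2\<omega>"
    and td1: "tangentially_differentiable D (trace_in D u\<omega>)"
    and td2: "tangentially_differentiable D (P_par D \<epsilon>\<omega> \<chi>par u\<omega>)"
    and tr1: "\<And>x. x \<in> frontier D \<Longrightarrow> trace_out D u\<omega> x = trace_in D u\<omega> x"
    and nd1: "\<And>x. x \<in> frontier D \<Longrightarrow> normal_deriv_out D u\<omega> x = \<epsilon>\<omega> * normal_deriv_in D u\<omega> x"
    and tr2: "\<And>x. x \<in> frontier D \<Longrightarrow> trace_out D u2\<omega> x - trace_in D u2\<omega> x
          = complex_of_real (4 * pi) * P_perp D \<epsilon>\<omega> \<chi>perp u\<omega> x"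
    and nd2: "\<And>x. x \<in> frontier D \<Longrightarrow> normal_deriv_out D u2\<omega> x - \<epsilon>2\<omega> * normal_deriv_in D u2\<omega> x
          = - complex_of_real (4 * pi) * surface_charge D \<epsilon>\<omega> \<chi>par u\<omega> x"
    and inf1: "(\<lambda>x. u\<omega> x - H x) \<in> O[at_infinity](\<lambda>x. complex_of_real (1 / norm x))"
    and inf2: "u2\<omega> \<in> o[at_infinity](\<lambda>x. 1)"
    using shg unfolding shg_system_def by blast+
  have fr: "frontier D = sphere 0 r\<^sub>0" using r by (simp add: D_def)
  have pf: "plane (rcis r\<^sub>0 t) \<in> frontier D" for t using r by (simp add: fr)
  obtain p q c where N: "\<And>t. normal_deriv_in D u\<omega> (plane (rcis r\<^sub>0 t)) = p * cis t + q * cis (- t)"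
    and T: "\<And>x. x \<in> frontier D \<Longrightarrow> trace_in D u\<omega> x = p * cplx x + q * cnj (cplx x) + c"
    using interior_field_affine[OF r C1[unfolded D_def] assms(3,6) h1[unfolded D_def] bv1[unfolded D_def] _ _ inf1] tr1 nd1
    unfolding D_def by blast
  have dT: "tangential_deriv D (trace_in D u\<omega>) (plane (rcis r\<^sub>0 t)) = p * (\<i> * cis t) + q * cnj (\<i> * cis t)" for t
    unfolding D_def
  proof (rule tangential_deriv_ball[OF r C1[unfolded D_def]])
    show "((\<lambda>z. p * z + q * cnj z + c) has_derivative (\<lambda>k. p * k + q * cnj k)) (at (rcis r\<^sub>0 t))"
      by (auto intro!: derivative_eq_intros)
  qed (use T td1 in \<open>auto simp: D_def\<close>)
  \<comment> \<open>The normal and tangential derivatives multiply to \<i> times a difference of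
    squares. Writing it with \<open>cplx x\<close>, of modulus \<open>r\<^sub>0\<close>, costs the
    division by the square of \<open>r\<^sub>0\<close>, but makes \<open>P_par\<close> the
    restriction of a polynomial in the plane, which \<open>tangential_deriv_ball\<close> can
    differentiate.\<close>
  define K where "K = 2 * \<i> * \<chi>par * \<epsilon>\<omega> / (of_real r\<^sub>0)\<^sup>2"
  have Ppar: "P_par D \<epsilon>\<omega> \<chi>par u\<omega> x = K * (p\<^sup>2 * (cplx x)\<^sup>2 - q\<^sup>2 * (cnj (cplx x))\<^sup>2)" if x: "x \<in> frontier D" for x
  proof -
    obtain t where t: "x = plane (rcis r\<^sub>0 t)" using frontier_ball_plane[OF r] x by (auto simp: D_def)
    show ?thesis unfolding P_par_def t N dT K_def using r
      by (simp add: rcis_def cis_cnj power_mult_distrib power2_eq_square field_simps)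
  qed
  have sc: "surface_charge D \<epsilon>\<omega> \<chi>par u\<omega> (plane (rcis r\<^sub>0 t)) =
      - (K * (p\<^sup>2 * (2 * rcis r\<^sub>0 t * (\<i> * cis t)) - q\<^sup>2 * (2 * cnj (rcis r\<^sub>0 t) * cnj (\<i> * cis t))))" for t
    unfolding surface_charge_def D_def
  proof (rule arg_cong[of _ _ uminus], rule tangential_deriv_ball[OF r C1[unfolded D_def]])
    show "((\<lambda>z. K * (p\<^sup>2 * z\<^sup>2 - q\<^sup>2 * (cnj z)\<^sup>2)) has_derivative
      (\<lambda>k. K * (p\<^sup>2 * (2 * rcis r\<^sub>0 t * k) - q\<^sup>2 * (2 * cnj (rcis r\<^sub>0 t) * cnj k)))) (at (rcis r\<^sub>0 t))"
      by (auto intro!: derivative_eq_intros simp: fun_eq_iff algebra_simps)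
  qed (use Ppar td2 in \<open>auto simp: D_def\<close>)
  have cis2: "cis t * cis t = cis (of_int 2 * t)" "cis (- t) * cis (- t) = cis (- of_int 2 * t)" "cis t * cis (- t) = 1" for t
    by (simp_all add: cis_mult)
  have jumpT: "fmode n (\<lambda>t. trace_out D u2\<omega> (plane (rcis r\<^sub>0 t)) - trace_in D u2\<omega> (plane (rcis r\<^sub>0 t))) = 0"
    if n: "\<bar>n\<bar> = 1" for n
  proof -
    let ?k = "complex_of_real (4 * pi) * \<chi>perp * \<epsilon>\<omega>\<^sup>2"
    have e: "trace_out D u2\<omega> (plane (rcis r\<^sub>0 t)) - trace_in D u2\<omega> (plane (rcis r\<^sub>0 t))
       = ?k * 2 * p * q + (?k * p\<^sup>2 * cis (of_int 2 * t) + ?k * q\<^sup>2 * cis (- of_int 2 * t))" for t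
    proof -
      have "(p * cis t + q * cis (- t))\<^sup>2 = p\<^sup>2 * (cis t * cis t) + q\<^sup>2 * (cis (- t) * cis (- t)) + 2 * p * q * (cis t * cis (- t))"
        unfolding power2_sum by (simp only: power2_eq_square mult_ac)
      also have "\<dots> = p\<^sup>2 * cis (of_int 2 * t) + q\<^sup>2 * cis (- of_int 2 * t) + 2 * p * q"
        unfolding cis2 by simp
      finally show ?thesis
        unfolding tr2[OF pf] P_perp_def N power_mult_distrib by (simp only: distrib_left mult_ac add_ac)
    qed
    have "n \<noteq> 0" "n \<noteq> 2" "n \<noteq> - 2" using n by auto
    note z = fmode_const[OF this(1)] fmode_cis_pair[OF this(2,3)]
    have "fmode n (\<lambda>t. ?k * 2 * p * q + (?k * p\<^sup>2 * cis (of_int 2 * t) + ?k * q\<^sup>2 * cis (- of_int 2 * t)))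
      = fmode n (\<lambda>t. ?k * 2 * p * q)
        + fmode n (\<lambda>t. ?k * p\<^sup>2 * cis (of_int 2 * t) + ?k * q\<^sup>2 * cis (- of_int 2 * t))"
      by (rule fmode_add) (intro continuous_intros)+
    then show ?thesis unfolding e z by simp
  qed
  have jumpN: "fmode n (\<lambda>t. normal_deriv_out D u2\<omega> (plane (rcis r\<^sub>0 t)) - \<epsilon>2\<omega> * normal_deriv_in D u2\<omega> (plane (rcis r\<^sub>0 t))) = 0"
    if n: "\<bar>n\<bar> = 1" for n
  proof -
    \<comment> \<open>The minus signs of the charge and of the jump condition cancel; 2, \<i> and
      \<open>r\<^sub>0\<close> come from differentiating the squares along the circle.\<close>
    let ?k = "complex_of_real (4 * pi) * K * 2 * \<i> * of_real r\<^sub>0"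
    have e: "normal_deriv_out D u2\<omega> (plane (rcis r\<^sub>0 t)) - \<epsilon>2\<omega> * normal_deriv_in D u2\<omega> (plane (rcis r\<^sub>0 t))
       = ?k * p\<^sup>2 * cis (of_int 2 * t) + ?k * q\<^sup>2 * cis (- of_int 2 * t)" for t
    proof -
      have "normal_deriv_out D u2\<omega> (plane (rcis r\<^sub>0 t)) - \<epsilon>2\<omega> * normal_deriv_in D u2\<omega> (plane (rcis r\<^sub>0 t))
       = ?k * p\<^sup>2 * (cis t * cis t) + ?k * q\<^sup>2 * (cis (- t) * cis (- t))"
        unfolding nd2[OF pf] sc by (simp add: rcis_def cis_cnj algebra_simps)
      then show ?thesis unfolding cis2 by simp
    qed
    have "n \<noteq> 2" "n \<noteq> - 2" using n by auto
    then show ?thesis unfolding e by (rule fmode_cis_pair)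
  qed
  have vim: "plane -` (- frontier D) = - sphere 0 r\<^sub>0" by (auto simp: fr)
  obtain F G where h: "hpair (u2\<omega> \<circ> plane) F G (- sphere 0 r\<^sub>0)"
    using harmonic_hpair[OF h2] unfolding vim by blast
  \<comment> \<open>The second harmonic field has background 0.\<close>
  have b0: "hpair (\<lambda>z. 0) (\<lambda>z. 0) (\<lambda>z. 0) UNIV" by (simp add: hpair_def)
  have lim0: "((u2\<omega> \<circ> plane) \<longlongrightarrow> 0) at_infinity"
    using filterlim_compose[OF smalloD_tendsto[OF inf2, simplified] plane_at_infinity] by (simp add: o_def)
  then have lim: "((\<lambda>z. (u2\<omega> \<circ> plane) z - 0) \<longlongrightarrow> 0) at_infinity" by (simp only: diff_zero)
  note ib = inside_boundary_modes[OF h r C1[unfolded D_def] bv2[unfolded D_def], folded D_def]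
  note ob = outside_boundary_modes[OF h r C1[unfolded D_def] bv2[unfolded D_def] b0 lim, folded D_def]
  have N0: "fmode n (\<lambda>t. normal_deriv_out D u2\<omega> (plane (rcis r\<^sub>0 t))) = 0" if n: "\<bar>n\<bar> = 1" for n
  proof -
    let ?Ni = "fmode n (\<lambda>t. normal_deriv_in D u2\<omega> (plane (rcis r\<^sub>0 t)))"
    let ?No = "fmode n (\<lambda>t. normal_deriv_out D u2\<omega> (plane (rcis r\<^sub>0 t)))"
    have n0: "n \<noteq> 0" using n by auto
    have "of_real r\<^sub>0 * ?Ni = fmode n (\<lambda>t. trace_in D u2\<omega> (plane (rcis r\<^sub>0 t)))"
      using ib(1)[OF n0] n by simp
    moreover have "of_real r\<^sub>0 * ?No = - fmode n (\<lambda>t. trace_out D u2\<omega> (plane (rcis r\<^sub>0 t)))"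
      using ob(1)[OF n0] n by (simp add: radial_def fmode_def)
    moreover have "fmode n (\<lambda>t. trace_out D u2\<omega> (plane (rcis r\<^sub>0 t))) = fmode n (\<lambda>t. trace_in D u2\<omega> (plane (rcis r\<^sub>0 t)))"
      using jumpT[OF n] fmode_diff[OF ob(4) ib(4), of n] by simp
    \<comment> \<open>The inner and outer traces share this mode, so the outer derivative mode is
      minus the inner one. The flux condition demands the factor \<open>\<epsilon>2\<omega>\<close>
      instead, and as this is not -1, both vanish.\<close>
    ultimately have "of_real r\<^sub>0 * (?No + ?Ni) = 0" by (simp add: distrib_left)
    then have *: "?No = - ?Ni" using r by (simp add: add_eq_0_iff2)
    have "?No = \<epsilon>2\<omega> * ?Ni"
      using jumpN[OF n] fmode_diff[OF ob(3) continuous_on_mult[OF continuous_on_const ib(3)], of n \<epsilon>2\<omega>]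
      by (simp add: fmode_cmult)
    with * have "(1 + \<epsilon>2\<omega>) * ?Ni = 0" by (simp add: algebra_simps)
    moreover have "1 + \<epsilon>2\<omega> \<noteq> 0" using assms(4) by (simp add: add_eq_0_iff)
    ultimately show ?thesis using * by simp
  qed
  have "- cball 0 r\<^sub>0 \<subseteq> - sphere 0 r\<^sub>0" by auto
  from hpair_subset[OF h _ this] have he: "hpair (u2\<omega> \<circ> plane) F G (- cball 0 r\<^sub>0)" by auto
  have Dl: "((\<lambda>\<rho>. fmode n (radial F G \<rho>)) \<longlongrightarrow> 0) (at_right r\<^sub>0)" if "\<bar>n\<bar> = 1" for n
    using ob(2)[of n] N0[OF that] by simp
  obtain C b where C: "\<And>z. b < norm z \<Longrightarrow> norm ((u2\<omega> \<circ> plane) z) \<le> C / (norm z)\<^sup>2"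
    by (rule exterior_decay[OF he lim0 r Dl Dl]) auto
  show ?thesis
  proof (rule bigoI)
    \<comment> \<open>\<open>eventually_at_infinity\<close> works with a non-strict bound on the
      norm, whence \<open>b + 1\<close>.\<close>
    have "norm (u2\<omega> x) \<le> C * norm (complex_of_real (1 / norm x ^ 2))" if "b + 1 \<le> norm x" for x
      using C[of "cplx x"] that norm_plane[of "cplx x"] by (simp add: norm_divide norm_power)
    then show "\<forall>\<^sub>F x in at_infinity. norm (u2\<omega> x) \<le> C * norm (complex_of_real (1 / norm x ^ 2))"
      unfolding eventually_at_infinity by blast
  qed
qed

end
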